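(* Suppose that $f\in\mathcal{B}$, $f(z)=\sum_{n=0}^{\infty}a_nz^n$, and let $S_r$ denote the area of the Riemann surface of the function $f^{-1}$ defined on the image of the subdisk $|z|<r$ under the mapping $f$. Then $$\sum_{n=0}^{\infty}|a_n|r^n+\left(\frac{1}{1+|a_0|}+\frac{r}{1-r}\right)\sum_{n=1}^{\infty}|a_n|^2r^{2n}+\frac{8}{9}\left(\frac{S_r}{\pi}\right)\le 1\quad\text{for } r\le\frac13,$$ and the numbers $1/3$ and $8/9$ cannot be improved. Moreover, $$|a_0|^2+\sum_{n=1}^{\infty}|a_n|r^n+\left(\frac{1}{1+|a_0|}+\frac{r}{1-r}\right)\sum_{n=1}^{\infty}|a_n|^2r^{2n}+\frac{9}{8}\left(\frac{S_r}{\pi}\right)\le 1\quad\text{for } r\le\frac{1}{3-|a_0|},$$ and the constant $9/8$ cannot be improved.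
   Context: $\mathbb{D}=\{z\in\mathbb{C}:|z|<1\}$ and $\mathcal{B}$ is the set of all analytic functions $f:\mathbb{D}\to\mathbb{D}$. The area $S_r$ (counted with multiplicity) is $S_r=\iint_{|z|<r}|f'(z)|^2\,dx\,dy=\pi\sum_{n=1}^{\infty}n|a_n|^2r^{2n}$. "Cannot be improved" means that the number in question cannot be replaced by any larger number (the other constants being kept) so that the corresponding inequality still holds for all $f\in\mathcal{B}$ and all $r$ in the stated range. *)

theory Defs
  imports "HOL-Complex_Analysis.Complex_Analysis"
begin

definition disc_self_maps :: "(complex \<Rightarrow> complex) set" where
  "disc_self_maps = {f. f holomorphic_on ball 0 1 \<and> f ` ball 0 1 \<subseteq> ball 0 1}"

definition taylor_coeff :: "(complex \<Rightarrow> complex) \<Rightarrow> nat \<Rightarrow> complex" where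
  "taylor_coeff f n = fps_nth (fps_expansion f 0) n"

(* Area of the image of the disc of radius r under f, counted with multiplicity:
   the Jacobian determinant of f, as a map of the real plane, is |f'|^2. *)
definition image_area :: "(complex \<Rightarrow> complex) \<Rightarrow> real \<Rightarrow> real" where
  "image_area f r = (LINT z:ball 0 r|lborel. (cmod (deriv f z))\<^sup>2)"

(* Series over n >= 1 are written with the index shifted by one. *)
definition refinement :: "(complex \<Rightarrow> complex) \<Rightarrow> real \<Rightarrow> real" where
  "refinement f r =
     (1 / (1 + cmod (taylor_coeff f 0)) + r / (1 - r)) *
     (\<Sum>n. (cmod (taylor_coeff f (Suc n)))\<^sup>2 * r ^ (2 * Suc n))"

definition bohr_sum :: "real \<Rightarrow> (complex \<Rightarrow> complex) \<Rightarrow> real \<Rightarrow> real" where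
  "bohr_sum c f r =
     (\<Sum>n. cmod (taylor_coeff f n) * r ^ n) + refinement f r + c * (image_area f r / pi)"

definition bohr_sum_sq :: "real \<Rightarrow> (complex \<Rightarrow> complex) \<Rightarrow> real \<Rightarrow> real" where
  "bohr_sum_sq c f r =
     (cmod (taylor_coeff f 0))\<^sup>2 + (\<Sum>n. cmod (taylor_coeff f (Suc n)) * r ^ Suc n)
     + refinement f r + c * (image_area f r / pi)"

end

theory Submission
  imports Defs
begin

text \<open>
  Write \<open>a = cmod a\<^sub>0\<close>. Multiplication by \<open>f\<close> is a contraction of the Hardy space. Testing it on
  suitable polynomials gives Carlson's bounds \<open>cmod a\<^sub>2\<^sub>n\<^sub>+\<^sub>1 \<le> 1 - (\<Sum>i\<le>n. (cmod a\<^sub>i)\<^sup>2)\<close> and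
  \<open>cmod a\<^sub>2\<^sub>n \<le> 1 - (\<Sum>i<n. (cmod a\<^sub>i)\<^sup>2) - (cmod a\<^sub>n)\<^sup>2 / (1 + a)\<close>, and summing these against \<open>r ^ n\<close> bounds
  the terms with \<open>n \<ge> 1\<close> together with the refinement by \<open>(1 - a\<^sup>2) * r / (1 - r)\<close>. Applied to the Schwarz
  function \<open>(f - a\<^sub>0) / (1 - cnj a\<^sub>0 * f)\<close>, the contraction property gives Rogosinski's inequality between
  the partial sums of \<open>(cmod a\<^sub>n)\<^sup>2\<close> and those of a disc automorphism; since \<open>n * r ^ (2 * n)\<close> is
  decreasing for \<open>r\<^sup>2 \<le> 1 / 2\<close>, Abel summation turns this into the area bound
  \<open>S\<^sub>r / pi \<le> (1 - a\<^sup>2)\<^sup>2 * r\<^sup>2 / (1 - a\<^sup>2 * r\<^sup>2)\<^sup>2\<close>. What is left are inequalities in \<open>a\<close>, which become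
  equalities to second order as \<open>a \<rightarrow> 1\<close>; hence disc automorphisms with \<open>a \<rightarrow> 1\<close> show sharpness.
\<close>

unbundle no fps_syntax

section \<open>Parseval's identity on discs and circles\<close>

text \<open>Open boxes of \<open>complex\<close> pull back to open boxes of \<open>real^2\<close>
  with the same side lengths, and the volumes of boxes determine Lebesgue measure. This makes the
  measure-preserving property of orthogonal maps of \<open>real^2\<close> available on
  \<open>complex\<close>.\<close>

lemma distr_real2_complex: "distr lborel borel (\<lambda>v::real^2. Complex (v$1) (v$2)) = lborel"
proof (rule lborel_eqI[symmetric])
  have m: "(\<lambda>v::real^2. Complex (v$1) (v$2)) \<in> borel_measurable borel"
    unfolding Complex_eq by (intro borel_measurable_continuous_onI continuous_intros)
  fix l u :: complex
  assume le: "\<And>b. b \<in> Basis \<Longrightarrow> l \<bullet> b \<le> u \<bullet> b"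
  let ?l = "vector [Re l, Im l] :: real^2" and ?u = "vector [Re u, Im u] :: real^2"
  have pre: "(\<lambda>v::real^2. Complex (v$1) (v$2)) -` box l u = box ?l ?u"
    unfolding set_eq_iff vimage_eq mem_box_cart forall_2 by (auto simp: mem_box Basis_complex_def)
  have B: "Basis = {axis 1 1, axis 2 (1::real) :: real^2}"
    by (auto simp: Basis_vec_def UNIV_2)
  have ne: "axis 1 1 \<noteq> (axis 2 (1::real) :: real^2)"
    by (simp add: axis_eq_axis)
  have "emeasure (distr lborel borel (\<lambda>v::real^2. Complex (v$1) (v$2))) (box l u) = emeasure lborel (box ?l ?u)"
    using m by (subst emeasure_distr) (auto simp: pre)
  also have "\<dots> = ennreal (\<Prod>b\<in>Basis. (?u - ?l) \<bullet> b)"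
    using le[of 1] le[of \<i>] by (intro emeasure_lborel_box) (auto simp: B inner_axis Basis_complex_def)
  also have "(\<Prod>b\<in>Basis. (?u - ?l) \<bullet> b) = (\<Prod>b\<in>Basis. (u - l) \<bullet> b)"
    using ne by (simp add: B inner_axis Basis_complex_def inner_diff_left)
  finally show "emeasure (distr lborel borel (\<lambda>v::real^2. Complex (v$1) (v$2))) (box l u) = 
      ennreal (\<Prod>b\<in>Basis. (u - l) \<bullet> b)" by simp
qed simp

text \<open>In real coordinates, multiplication by a unimodular number is an orthogonal
  transformation, so the volume of every box is preserved.\<close>

lemma distr_lborel_rotate:
  fixes u :: complex
  assumes "cmod u = 1"
  shows "distr lborel borel (\<lambda>z. u * z) = lborel"
proof (rule lborel_eqI[symmetric])
  let ?\<phi> = "\<lambda>v::real^2. Complex (v$1) (v$2)"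
  let ?\<psi> = "\<lambda>z::complex. vector [Re z, Im z] :: real^2"
  have \<phi>\<psi>: "?\<phi> (?\<psi> z) = z" for z by simp
  have \<psi>\<phi>: "?\<psi> (?\<phi> v) = v" for v by (simp add: vec_eq_iff forall_2)
  have m: "?\<phi> \<in> borel_measurable borel"
    unfolding Complex_eq by (intro borel_measurable_continuous_onI continuous_intros)
  have em: "emeasure lborel A = emeasure lborel (?\<phi> -` A)" if "A \<in> sets borel" for A
    using that m by (subst distr_real2_complex[symmetric], subst emeasure_distr) auto
  have inv: "u * cnj u = 1" "cnj u * u = 1"
    using assms by (simp_all add: complex_norm_square[symmetric] mult.commute)
  fix l r :: complex
  assume le: "\<And>b. b \<in> Basis \<Longrightarrow> l \<bullet> b \<le> r \<bullet> b"
  let ?B = "?\<phi> -` box l r"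
  \<comment> \<open>Multiplication by \<open>cnj u\<close> inverts the rotation. The preimage of a
    box under the rotation is therefore its image under \<open>?f\<close>, to which the result on
    orthogonal images applies.\<close>
  let ?f = "\<lambda>v. ?\<psi> (cnj u * ?\<phi> v)"
  have B: "?B = box (?\<psi> l) (?\<psi> r)"
    unfolding set_eq_iff vimage_eq mem_box_cart forall_2 by (auto simp: mem_box Basis_complex_def)
  have lin: "linear ?f"
    by (rule linearI) (auto simp: vec_eq_iff forall_2 algebra_simps)
  have nrm: "norm v = cmod (?\<phi> v)" for v
    by (simp add: norm_vec_def L2_set_def sum_2 cmod_def)
  have orth: "orthogonal_transformation ?f"
    unfolding orthogonal_transformation using lin assms
    unfolding nrm \<phi>\<psi> by (simp add: norm_mult del: complex_cnj_mult)
  have im: "?f ` ?B = ?\<phi> -` ((\<lambda>z. u * z) -` box l r)"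
  proof (intro set_eqI iffI)
    fix v assume "v \<in> ?f ` ?B"
    then obtain w where w: "?\<phi> w \<in> box l r" "v = ?f w" by auto
    have "u * ?\<phi> v = (u * cnj u) * ?\<phi> w"
      unfolding w(2) \<phi>\<psi> by simp
    thus "v \<in> ?\<phi> -` ((\<lambda>z. u * z) -` box l r)"
      using w by (simp add: inv)
  next
    fix v assume v: "v \<in> ?\<phi> -` ((\<lambda>z. u * z) -` box l r)"
    have "?f (?\<psi> (u * ?\<phi> v)) = ?\<psi> ((cnj u * u) * ?\<phi> v)"
      unfolding \<phi>\<psi> by (simp only: mult.assoc)
    also have "\<dots> = v" unfolding inv by (simp add: vec_eq_iff forall_2)
    finally have "v = ?f (?\<psi> (u * ?\<phi> v))" by simp
    moreover have "?\<psi> (u * ?\<phi> v) \<in> ?B" using v unfolding vimage_eq \<phi>\<psi> by simp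
    ultimately show "v \<in> ?f ` ?B" by blast
  qed
  have S: "?B \<in> lmeasurable" unfolding B by simp
  note L = measurable_orthogonal_image[OF orth S] measure_orthogonal_image[OF orth S]
  have pb: "?\<phi> -` ((\<lambda>z. u * z) -` box l r) \<in> sets borel"
  proof -
    have "(\<lambda>z. u * z) -` box l r \<in> sets borel"
      by (intro borel_open open_vimage continuous_intros open_box)
    thus ?thesis using measurable_sets[OF m] by simp
  qed
  have "emeasure (distr lborel borel (\<lambda>z. u * z)) (box l r) = emeasure lborel ((\<lambda>z. u * z) -` box l r)"
    by (subst emeasure_distr) auto
  also have "\<dots> = emeasure lborel (?f ` ?B)"
    unfolding im by (rule em) (intro borel_open open_vimage continuous_intros open_box)
  also have "\<dots> = emeasure lebesgue (?f ` ?B)"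
    using pb unfolding im by simp
  also have "\<dots> = emeasure lebesgue ?B"
    using L S by (simp add: emeasure_eq_measure2)
  also have "\<dots> = emeasure lborel ?B" by (simp add: B)
  also have "\<dots> = emeasure lborel (box l r)" by (rule em[symmetric]) simp
  also have "\<dots> = (\<Prod>b\<in>Basis. (r - l) \<bullet> b)" using le by (intro emeasure_lborel_box) auto
  finally show "emeasure (distr lborel borel (\<lambda>z. u * z)) (box l r) = (\<Prod>b\<in>Basis. (r - l) \<bullet> b)" .
qed simp

text \<open>The area of a disc is linear in the square of its radius, so the squared modulus has
  constant density \<open>pi\<close>. This serves in place of polar coordinates. It is enough to
  compare the masses of the half-lines \<open>{x<..}\<close>.\<close>

lemma distr_cmod_square_ball:
  fixes r :: real
  assumes "r \<ge> 0"
  shows "distr (restrict_space lborel (ball (0::complex) r)) borel (\<lambda>z. (cmod z)\<^sup>2)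
    = density lborel (\<lambda>t. ennreal (pi * indicator {0..r\<^sup>2} t))" (is "?M = ?N")
proof (rule measure_eqI_lessThan)
  have vol: "emeasure lborel (ball (0::complex) s) = ennreal (pi * s\<^sup>2)" if "s \<ge> 0" for s
    using emeasure_ball[OF that, of "0::complex"] by (simp add: unit_ball_vol_2)
  have volc: "emeasure lborel (cball (0::complex) s) = ennreal (pi * s\<^sup>2)" if "s \<ge> 0" for s
    using emeasure_cball[OF that, of "0::complex"] by (simp add: unit_ball_vol_2)
  have meas: "(\<lambda>z. (cmod z)\<^sup>2) \<in> borel_measurable (restrict_space lborel (ball 0 r))"
    by (intro measurable_restrict_space1) simp
  have pre: "emeasure ?M {x<..} = emeasure lborel (ball (0::complex) r - {z. (cmod z)\<^sup>2 \<le> x})" for x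
  proof -
    have "emeasure ?M {x<..} = emeasure (restrict_space lborel (ball 0 r)) 
        ((\<lambda>z. (cmod z)\<^sup>2) -` {x<..} \<inter> ball 0 r)"
      using meas by (subst emeasure_distr) (auto simp: space_restrict_space)
    also have "(\<lambda>z. (cmod z)\<^sup>2) -` {x<..} \<inter> ball 0 r = ball (0::complex) r - {z. (cmod z)\<^sup>2 \<le> x}"
      by auto
    finally show ?thesis by (subst (asm) emeasure_restrict_space) auto
  qed
  have M: "emeasure ?M {x<..} = ennreal (pi * (r\<^sup>2 - max 0 (min x (r\<^sup>2))))" for x
  proof -
    consider "x < 0" | "0 \<le> x" "x < r\<^sup>2" | "r\<^sup>2 \<le> x" by linarith
    thus ?thesis
    proof cases
      case 1
      hence "{z. (cmod z)\<^sup>2 \<le> x} = {}"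
        using not_le order_less_le_trans zero_le_power2 by (metis (no_types, lifting) empty_Collect_eq)
      moreover have "x \<le> r\<^sup>2" using 1 zero_le_power2[of r] by linarith
      ultimately show ?thesis unfolding pre using 1 by (simp add: vol assms min_def)
    next
      case 2
      have eq: "{z. (cmod z)\<^sup>2 \<le> x} = cball 0 (sqrt x)"
        using 2(1) by (auto simp: real_le_rsqrt real_sqrt_le_iff' intro: real_le_rsqrt)
          (metis norm_ge_zero power_mono real_sqrt_pow2)
      have sub: "cball 0 (sqrt x) \<subseteq> ball (0::complex) r"
        using 2 assms real_sqrt_less_mono[of x "r\<^sup>2"] by auto
      have "emeasure lborel (ball (0::complex) r - cball 0 (sqrt x)) =
          emeasure lborel (ball (0::complex) r) - emeasure lborel (cball (0::complex) (sqrt x))"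
        using sub 2 by (intro emeasure_Diff) (auto simp: volc)
      also have "\<dots> = ennreal (pi * r\<^sup>2 - pi * x)"
        using 2 assms by (simp add: vol volc ennreal_minus)
      finally show ?thesis unfolding pre eq using 2 by (simp add: algebra_simps)
    next
      case 3
      have e: "ball 0 r \<subseteq> {z. (cmod z)\<^sup>2 \<le> x}"
      proof clarify
        fix z :: complex assume "z \<in> ball 0 r"
        hence "(cmod z)\<^sup>2 \<le> r\<^sup>2" by (intro power_mono) auto
        thus "(cmod z)\<^sup>2 \<le> x" using 3 by linarith
      qed
      hence empty: "ball (0::complex) r - {z. (cmod z)\<^sup>2 \<le> x} = {}" by blast
      show ?thesis unfolding pre empty using 3 by (simp add: min_def)
    qed
  qed
  have N: "emeasure ?N {x<..} = ennreal (pi * (r\<^sup>2 - max 0 (min x (r\<^sup>2))))" for x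
  proof -
    have "emeasure ?N {x<..} = (\<integral>\<^sup>+t. ennreal pi * indicator ({0..r\<^sup>2} \<inter> {x<..}) t \<partial>lborel)"
      by (subst emeasure_density) (auto intro!: nn_integral_cong simp: indicator_def)
    also have "\<dots> = ennreal pi * emeasure lborel ({0..r\<^sup>2} \<inter> {x<..})"
      by (subst nn_integral_cmult_indicator) auto
    also have "emeasure lborel ({0..r\<^sup>2} \<inter> {x<..}) = ennreal (r\<^sup>2 - max 0 (min x (r\<^sup>2)))"
    proof -
      consider "x < 0" | "0 \<le> x" "x < r\<^sup>2" | "r\<^sup>2 \<le> x" by linarith
      thus ?thesis
      proof cases
        case 1
        hence "{0..r\<^sup>2} \<inter> {x<..} = {0..r\<^sup>2}" by auto
        moreover have "x \<le> r\<^sup>2" using 1 zero_le_power2[of r] by linarith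
        ultimately show ?thesis using 1 by (simp add: min_def)
      next
        case 2
        hence "{0..r\<^sup>2} \<inter> {x<..} = {x<..r\<^sup>2}" by auto
        with 2 show ?thesis by simp
      next
        case 3
        hence e: "{0..r\<^sup>2} \<inter> {x<..} = {}" by auto
        show ?thesis using 3 unfolding e by (simp add: min_def)
      qed
    qed
    finally show ?thesis by (simp add: ennreal_mult')
  qed
  show "emeasure ?M {x<..} < \<infinity>" for x unfolding M by simp
  show "emeasure ?M {x<..} = emeasure ?N {x<..}" for x unfolding M N ..
qed auto


text \<open>The substitution \<open>t = (cmod z)\<^sup>2\<close> reduces the integral to that of
  \<open>pi * t ^ n\<close> over \<open>{0..r\<^sup>2}\<close>.\<close>

lemma integral_ball_cmod_power:
  fixes r :: real
  assumes "r \<ge> 0"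
  shows "(\<integral>z. cmod z ^ (2 * n) \<partial>restrict_space lborel (ball (0::complex) r)) = pi * r ^ (2 * n + 2) / (n + 1)"
proof -
  let ?M = "restrict_space lborel (ball (0::complex) r)"
  have "(\<integral>z. cmod z ^ (2 * n) \<partial>?M) = (\<integral>t. t ^ n \<partial>distr ?M borel (\<lambda>z. (cmod z)\<^sup>2))"
    by (subst integral_distr) (auto simp: power_mult intro!: measurable_restrict_space1)
  also have "\<dots> = (\<integral>t. (pi * indicator {0..r\<^sup>2} t) *\<^sub>R t ^ n \<partial>lborel)"
    unfolding distr_cmod_square_ball[OF assms] by (subst integral_density) auto
  also have "\<dots> = (\<integral>t. (pi * t ^ n) * indicator {0..r\<^sup>2} t \<partial>lborel)"
    by (intro Bochner_Integration.integral_cong) auto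
  also have "\<dots> = pi * (r\<^sup>2) ^ (n + 1) / (n + 1) - pi * 0 ^ (n + 1) / (n + 1)"
  proof (rule integral_FTC_Icc_real)
    fix x :: real
    show "((\<lambda>t. pi * t ^ (n + 1) / (n + 1)) has_real_derivative pi * x ^ n) (at x)"
      by (auto intro!: derivative_eq_intros simp del: power_Suc)
    show "isCont (\<lambda>t. pi * t ^ n) x" by (intro continuous_intros)
  qed simp
  also have "\<dots> = pi * r ^ (2 * n + 2) / (n + 1)"
    by (simp add: power_mult power2_eq_square)
  finally show ?thesis .
qed

text \<open>Rotation by \<open>u\<close> multiplies the integral by \<open>u ^ m * cnj u ^ n\<close>, which is not 1 for a
  suitable \<open>u\<close>.\<close>

lemma integral_ball_monomials_orthogonal:
  fixes r :: real
  assumes "m \<noteq> n"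
  shows "(\<integral>z. z ^ m * cnj z ^ n \<partial>restrict_space lborel (ball (0::complex) r)) = 0"
proof -
  define d where "d = real m - real n"
  define u where "u = cis (1 / d)"
  define F where "F = (\<lambda>z::complex. indicator (ball 0 r) z *\<^sub>R (z ^ m * cnj z ^ n))"
  have d: "d \<noteq> 0" using assms by (simp add: d_def)
  have u: "cmod u = 1" by (simp add: u_def)
  have "u ^ m * cnj u ^ n = cis (real m * (1/d) - real n * (1/d))"
    unfolding u_def cis_cnj Complex.DeMoivre cis_mult by simp
  also have "real m * (1/d) - real n * (1/d) = 1"
    using d by (simp add: d_def diff_divide_distrib[symmetric])
  finally have um: "u ^ m * cnj u ^ n = cis 1" .
  have "cis 1 \<noteq> 1"
  proof
    assume "cis 1 = 1"
    hence "cos (1::real) = 1" by (metis cis.sel(1) one_complex.sel(1))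
    thus False using cos_monotone_0_pi[of 0 1] pi_gt3 by simp
  qed
  have mF: "F \<in> borel_measurable borel"
    unfolding F_def by (intro borel_measurable_continuous_on_indicator continuous_intros) simp
  have "(\<integral>z. F z \<partial>lborel) = (\<integral>z. F z \<partial>distr lborel borel (\<lambda>z. u * z))"
    by (simp add: distr_lborel_rotate[OF u])
  also have "\<dots> = (\<integral>z. F (u * z) \<partial>lborel)"
    using mF by (subst integral_distr) auto
  also have "\<dots> = (\<integral>z. cis 1 * F z \<partial>lborel)"
    by (intro Bochner_Integration.integral_cong)
      (auto simp: F_def indicator_def norm_mult u power_mult_distrib um[symmetric])
  also have "\<dots> = cis 1 * (\<integral>z. F z \<partial>lborel)" by simp
  finally have "(\<integral>z. F z \<partial>lborel) = 0" using \<open>cis 1 \<noteq> 1\<close> by simp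
  thus ?thesis by (subst integral_restrict_space) (auto simp: F_def)
qed

text \<open>Stated for any finite measure with orthogonal monomials, so that it serves both area on
  a disc and the angular measure on a circle. The partial sums are bounded uniformly by the
  absolutely convergent series at \<open>R\<close>, which permits dominated convergence;
  orthogonality leaves only the diagonal of the double sum.\<close>

lemma parseval_circular:
  fixes M :: "complex measure" and c :: "nat \<Rightarrow> complex"
  assumes "finite_measure M" and sets: "sets M = sets (restrict_space borel S)"
    and R: "\<And>z. z \<in> space M \<Longrightarrow> cmod z \<le> R"
    and c: "summable (\<lambda>n. cmod (c n) * R ^ n)"
    and orth: "\<And>m n. m \<noteq> n \<Longrightarrow> (\<integral>z. z ^ m * cnj z ^ n \<partial>M) = 0"
    and g: "g \<in> borel_measurable M" "\<And>z. z \<in> space M \<Longrightarrow> (\<lambda>n. c n * z ^ n) sums g z"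
  shows "(\<lambda>n. (cmod (c n))\<^sup>2 * (\<integral>z. cmod z ^ (2 * n) \<partial>M)) sums (\<integral>z. (cmod (g z))\<^sup>2 \<partial>M)"
    and "integrable M (\<lambda>z. (cmod (g z))\<^sup>2)"
proof -
  interpret finite_measure M by fact
  define P where "P = (\<lambda>N z. \<Sum>k<N. c k * z ^ k)"
  define B where "B = (\<Sum>n. cmod (c n) * R ^ n)"
  have mon: "(\<lambda>z. z ^ m * cnj z ^ n) \<in> borel_measurable M" for m n
    unfolding measurable_cong_sets[OF sets refl]
    by (intro measurable_restrict_space1 borel_measurable_continuous_onI continuous_intros)
  have int: "integrable M (\<lambda>z. z ^ m * cnj z ^ n)" for m n
    by (rule integrable_const_bound[OF _ mon, where B = "R ^ m * R ^ n"])
      (auto simp: norm_mult norm_power intro!: AE_I2 mult_mono power_mono R zero_le_power order.trans[OF norm_ge_zero R])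
  have P: "cmod (P N z) \<le> B" if "z \<in> space M" for N z
  proof -
    have R0: "0 \<le> R" using R[OF that] norm_ge_zero[of z] by linarith
    have "cmod (P N z) \<le> (\<Sum>k<N. cmod (c k) * R ^ k)"
      unfolding P_def using R[OF that] 
      by (intro sum_norm_le) (auto simp: norm_mult norm_power intro!: mult_left_mono power_mono)
    also have "\<dots> \<le> B" unfolding B_def
      by (intro sum_le_suminf c) (auto simp: R0)
    finally show ?thesis .
  qed
  have Pm: "P N \<in> borel_measurable M" for N
    using mon[of _ 0] unfolding P_def by (intro borel_measurable_sum borel_measurable_times) simp_all
  have bd: "(cmod (P N z))\<^sup>2 \<le> B\<^sup>2" if "z \<in> space M" for N z
    using P[OF that] by (intro power_mono) auto
  have lim: "(\<lambda>N. (cmod (P N z))\<^sup>2) \<longlonglongrightarrow> (cmod (g z))\<^sup>2" if "z \<in> space M" for z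
    using g(2)[OF that] unfolding sums_def P_def by (intro tendsto_intros)
  have gb: "(cmod (g z))\<^sup>2 \<le> B\<^sup>2" if "z \<in> space M" for z
    by (rule LIMSEQ_le_const2[OF lim[OF that]]) (use bd[OF that] in blast)
  show "integrable M (\<lambda>z. (cmod (g z))\<^sup>2)"
    by (rule integrable_const_bound[where B = "B\<^sup>2"]) (use g(1) gb in auto)
  have "(\<lambda>N. \<integral>z. (cmod (P N z))\<^sup>2 \<partial>M) \<longlonglongrightarrow> (\<integral>z. (cmod (g z))\<^sup>2 \<partial>M)"
    by (rule integral_dominated_convergence[where w = "\<lambda>_. B\<^sup>2"]) (use g(1) Pm lim bd in auto)
  moreover have "(\<integral>z. (cmod (P N z))\<^sup>2 \<partial>M) = (\<Sum>n<N. (cmod (c n))\<^sup>2 * (\<integral>z. cmod z ^ (2 * n) \<partial>M))" for N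
  proof -
    have diag: "(\<integral>z. z ^ n * cnj z ^ n \<partial>M) = of_real (\<integral>z. cmod z ^ (2 * n) \<partial>M)" for n
    proof -
      have "z ^ n * cnj z ^ n = of_real (cmod z ^ (2 * n))" for z
        unfolding power_mult of_real_power[of _ n] complex_norm_square by (simp add: power_mult_distrib)
      thus ?thesis by (simp only: integral_complex_of_real)
    qed
    have "complex_of_real (\<integral>z. (cmod (P N z))\<^sup>2 \<partial>M) = (\<integral>z. of_real ((cmod (P N z))\<^sup>2) \<partial>M)"
      by (rule integral_complex_of_real[symmetric])
    also have "\<dots> = (\<integral>z. (\<Sum>m<N. \<Sum>n<N. (c m * cnj (c n)) * (z ^ m * cnj z ^ n)) \<partial>M)"
      unfolding complex_norm_square P_def
      by (intro Bochner_Integration.integral_cong refl) (simp add: sum_product mult_ac)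
    also have "\<dots> = (\<Sum>m<N. \<Sum>n<N. (c m * cnj (c n)) * (\<integral>z. z ^ m * cnj z ^ n \<partial>M))"
      by (simp add: Bochner_Integration.integral_sum Bochner_Integration.integrable_sum int)
    also have "\<dots> = (\<Sum>m<N. \<Sum>n<N. if n = m then (c m * cnj (c m)) * (\<integral>z. z ^ m * cnj z ^ m \<partial>M) else 0)"
      by (intro sum.cong refl) (auto simp: orth)
    also have "\<dots> = (\<Sum>m<N. (c m * cnj (c m)) * (\<integral>z. z ^ m * cnj z ^ m \<partial>M))"
      by simp
    also have "\<dots> = of_real (\<Sum>n<N. (cmod (c n))\<^sup>2 * (\<integral>z. cmod z ^ (2 * n) \<partial>M))"
      unfolding of_real_sum of_real_mult complex_norm_square diag ..
    finally show ?thesis by (simp only: of_real_eq_iff)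
  qed
  ultimately show "(\<lambda>n. (cmod (c n))\<^sup>2 * (\<integral>z. cmod z ^ (2 * n) \<partial>M)) sums (\<integral>z. (cmod (g z))\<^sup>2 \<partial>M)"
    by (simp add: sums_def)
qed

section \<open>Taylor coefficients, the area series and integration over circles\<close>

lemma disc_self_mapsD:
  assumes "f \<in> disc_self_maps"
  shows "f holomorphic_on ball 0 1" "\<And>z. cmod z < 1 \<Longrightarrow> cmod (f z) < 1"
  using assms unfolding disc_self_maps_def by (auto simp: image_subset_iff)

lemma taylor_coeff_sums:
  assumes "f holomorphic_on ball 0 1" "cmod z < 1"
  shows "(\<lambda>n. taylor_coeff f n * z ^ n) sums f z"
proof -
  have "f has_fps_expansion fps_expansion f 0"
    using assms by (intro has_fps_expansion_fps_expansion[of "ball 0 1"]) auto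
  moreover have "f holomorphic_on eball 0 1"
    using assms(1) by (metis eball_ereal one_ereal_def)
  ultimately show ?thesis
    unfolding taylor_coeff_def using assms(2) by (intro has_fps_expansion_imp_sums_complex[where r = 1]) auto
qed

lemma taylor_coeff_summable:
  assumes "f holomorphic_on ball 0 1" "0 \<le> r" "r < 1"
  shows "summable (\<lambda>n. cmod (taylor_coeff f n) * r ^ n)"
proof -
  define s where "s = (1 + r) / 2"
  have s: "r < s" "s < 1" using assms by (auto simp: s_def)
  have "summable (\<lambda>n. taylor_coeff f n * (of_real s) ^ n)"
    using taylor_coeff_sums[OF assms(1), of "of_real s"] s assms by (auto simp: sums_iff)
  hence "summable (\<lambda>n. cmod (taylor_coeff f n * (of_real r) ^ n))"
    by (rule powser_insidea) (use s assms in auto)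
  thus ?thesis using assms by (simp add: norm_mult norm_power)
qed

text \<open>Parseval's identity for \<open>deriv f\<close> on the disc. Its coefficients carry a
  factor \<open>Suc n\<close>, which is squared; \<open>integral_ball_cmod_power\<close> divides by
  \<open>n + 1\<close> once, so a single factor remains.\<close>

lemma image_area_sums:
  assumes "f holomorphic_on ball 0 1" "0 \<le> r" "r < 1"
  shows "(\<lambda>n. real (Suc n) * (cmod (taylor_coeff f (Suc n)))\<^sup>2 * r ^ (2 * Suc n)) sums (image_area f r / pi)"
proof -
  let ?M = "restrict_space lborel (ball (0::complex) r)"
  define c where "c = (\<lambda>n. taylor_coeff (deriv f) n)"
  have hol: "deriv f holomorphic_on ball 0 1"
    using assms(1) by (intro holomorphic_deriv) auto
  have c: "c n = of_nat (Suc n) * taylor_coeff f (Suc n)" for n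
    unfolding c_def taylor_coeff_def fps_expansion_def
    by (simp add: funpow_Suc_right field_simps del: funpow.simps of_nat_Suc)
  have "finite_measure ?M"
    using emeasure_lborel_ball_finite[of "0::complex" r]
    by (intro finite_measureI) (simp add: space_restrict_space emeasure_restrict_space less_top)
  have "deriv f \<in> borel_measurable ?M"
  proof -
    have "continuous_on (ball 0 r) (deriv f)"
      by (rule continuous_on_subset[OF holomorphic_on_imp_continuous_on[OF hol]]) (use assms in auto)
    from borel_measurable_continuous_on_restrict[OF this] show ?thesis
      by (simp add: measurable_def sets_restrict_space space_restrict_space)
  qed
  hence "(\<lambda>n. (cmod (c n))\<^sup>2 * (\<integral>z. cmod z ^ (2 * n) \<partial>?M)) sums (\<integral>z. (cmod (deriv f z))\<^sup>2 \<partial>?M)"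
    using taylor_coeff_sums[OF hol] assms
    by (intro parseval_circular(1)[where R = r and S = "ball 0 r"] \<open>finite_measure ?M\<close> integral_ball_monomials_orthogonal
          taylor_coeff_summable[OF hol, folded c_def])
       (auto simp: c_def space_restrict_space sets_restrict_space)
  also have "(\<integral>z. (cmod (deriv f z))\<^sup>2 \<partial>?M) = image_area f r"
    unfolding image_area_def set_lebesgue_integral_def by (subst integral_restrict_space) auto
  finally have "(\<lambda>n. (cmod (c n))\<^sup>2 * (\<integral>z. cmod z ^ (2 * n) \<partial>?M) / pi) sums (image_area f r / pi)"
    by (intro sums_divide)
  moreover have "(cmod (c n))\<^sup>2 * (\<integral>z. cmod z ^ (2 * n) \<partial>?M) / pi = 
     real (Suc n) * (cmod (taylor_coeff f (Suc n)))\<^sup>2 * r ^ (2 * Suc n)" for n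
    unfolding integral_ball_cmod_power[OF assms(2)] c
    by (simp add: norm_mult power_mult_distrib power2_eq_square field_simps del: of_nat_Suc)
  ultimately show ?thesis by simp
qed

text \<open>\<open>M\<close> is the angular measure, not normalised. As \<open>m - n\<close> is a
  nonzero integer, the primitive of \<open>cis (d * t)\<close> takes equal values at
  \<open>0\<close> and \<open>2 * pi\<close>, which gives orthogonality.\<close>

lemma circle_measure:
  fixes \<rho> :: real
  assumes "\<rho> \<ge> 0"
  defines "M \<equiv> distr (restrict_space lborel {0..2 * pi}) (restrict_space borel (sphere 0 \<rho>)) (\<lambda>t. of_real \<rho> * cis t)"
  shows "finite_measure M" "measure M (space M) = 2 * pi"
    and "m \<noteq> n \<Longrightarrow> (\<integral>z. z ^ m * cnj z ^ n \<partial>M) = 0"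
proof -
  let ?I = "restrict_space lborel {0..2 * pi}"
  have mc: "(\<lambda>t. of_real \<rho> * cis t) \<in> measurable ?I (restrict_space borel (sphere 0 \<rho>))"
    using assms(1) by (intro measurable_restrict_space2 measurable_restrict_space1)
      (auto simp: norm_mult intro!: borel_measurable_continuous_onI continuous_intros)
  have fin: "finite_measure ?I"
    by (intro finite_measureI) (simp add: space_restrict_space emeasure_restrict_space)
  show "finite_measure M" unfolding M_def
    by (rule finite_measure.finite_measure_distr[OF fin mc])
  have "measure M (space M) = measure ?I (space ?I)"
    unfolding M_def by (subst measure_distr[OF mc]) (use measurable_space[OF mc] sets.top[of "restrict_space borel (sphere (0::complex) \<rho>)"] in \<open>auto intro!: arg_cong[where f = "measure _"]\<close>)
  thus "measure M (space M) = 2 * pi" by (simp add: space_restrict_space measure_restrict_space)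
  assume "m \<noteq> n"
  define d where "d = real m - real n"
  have d: "d \<noteq> 0" using \<open>m \<noteq> n\<close> by (simp add: d_def)
  have "(\<integral>z. z ^ m * cnj z ^ n \<partial>M) = (\<integral>t. (of_real \<rho> * cis t) ^ m * cnj (of_real \<rho> * cis t) ^ n \<partial>?I)"
    unfolding M_def
    by (subst integral_distr[OF mc])
      (auto intro!: measurable_restrict_space1 borel_measurable_continuous_onI continuous_intros)
  also have "\<dots> = (\<integral>t. of_real (\<rho> ^ (m + n)) * cis (d * t) \<partial>?I)"
  proof (intro Bochner_Integration.integral_cong refl)
    fix t
    have "cis t ^ m * cis (- t) ^ n = cis (d * t)"
      unfolding Complex.DeMoivre cis_mult d_def by (simp add: algebra_simps)
    thus "(of_real \<rho> * cis t) ^ m * cnj (of_real \<rho> * cis t) ^ n = of_real (\<rho> ^ (m + n)) * cis (d * t)"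
      unfolding complex_cnj_mult cis_cnj power_mult_distrib by (simp add: power_add mult_ac)
  qed
  also have "\<dots> = of_real (\<rho> ^ (m + n)) * (\<integral>t. indicator {0..2 * pi} t *\<^sub>R cis (d * t) \<partial>lborel)"
    by (simp add: integral_restrict_space)
  also have "(\<integral>t. indicator {0..2 * pi} t *\<^sub>R cis (d * t) \<partial>lborel) = 
      cis (d * (2 * pi)) / (\<i> * d) - cis (d * 0) / (\<i> * d)"
  proof (rule integral_FTC_atLeastAtMost)
    show "continuous_on {0..2 * pi} (\<lambda>t. cis (d * t))" by (intro continuous_intros)
    fix x :: real
    have "((\<lambda>t. exp (\<i> * of_real d * of_real t) / (\<i> * d)) has_vector_derivative exp (\<i> * of_real d * of_real x)) (at x)"
      using d by (auto intro!: has_vector_derivative_real_field derivative_eq_intros)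
    moreover have "cis (d * t) = exp (\<i> * of_real d * of_real t)" for t
      by (simp add: cis_conv_exp mult.assoc)
    ultimately show "((\<lambda>t. cis (d * t) / (\<i> * d)) has_vector_derivative cis (d * x)) (at x within {0..2 * pi})"
      by (simp only: has_vector_derivative_at_within)
  qed simp
  also have "cis (d * (2 * pi)) = 1"
  proof -
    have "d = of_int (int m - int n)" by (simp add: d_def)
    thus ?thesis using cis_multiple_2pi[of d] by (simp add: mult_ac)
  qed
  finally show "(\<integral>z. z ^ m * cnj z ^ n \<partial>M) = 0" by simp
qed

section \<open>Carlson's coefficient bounds\<close>

text \<open>Multiplication by \<open>f\<close> is a contraction of the Hardy space; truncating \<open>P\<close> and letting the
  radius of the circle of integration tend to 1 gives the statement about coefficients.\<close>

lemma multiplier_contraction: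
  assumes "f \<in> disc_self_maps"
  shows "(\<Sum>k\<le>N. (cmod (fps_nth (fps_expansion f 0 * P) k))\<^sup>2) \<le> (\<Sum>k\<le>N. (cmod (fps_nth P k))\<^sup>2)"
proof -
  note f = disc_self_mapsD[OF assms]
  define p where "p = (\<lambda>z. \<Sum>k\<le>N. fps_nth P k * z ^ k)"
  \<comment> \<open>Truncating at \<open>N\<close> leaves the coefficients of the product up to
    index \<open>N\<close> unchanged, and turns Parseval's identity for \<open>p\<close> into a
    finite sum.\<close>
  define Q where "Q = (\<Sum>k\<le>N. fps_const (fps_nth P k) * fps_X ^ k)"
  define h where "h = (\<lambda>z. f z * p z)"
  have Q: "fps_nth Q k = (if k \<le> N then fps_nth P k else 0)" for k
    by (simp add: Q_def fps_sum_nth if_distrib cong: if_cong)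
  have pQ: "p has_fps_expansion Q"
    unfolding p_def Q_def by (intro fps_expansion_intros)
  have ph: "p holomorphic_on ball 0 1"
    unfolding p_def by (intro holomorphic_intros)
  have hh: "h holomorphic_on ball 0 1"
    unfolding h_def by (intro holomorphic_intros f ph)
  have "f has_fps_expansion fps_expansion f 0"
    using f by (intro has_fps_expansion_fps_expansion[of "ball 0 1"]) auto
  hence "h has_fps_expansion fps_expansion f 0 * Q"
    unfolding h_def by (intro has_fps_expansion_mult pQ)
  hence h: "taylor_coeff h k = fps_nth (fps_expansion f 0 * Q) k" for k
    by (simp add: taylor_coeff_def fps_expansion_eqI)
  have hP: "taylor_coeff h k = fps_nth (fps_expansion f 0 * P) k" if "k \<le> N" for k
    unfolding h fps_mult_nth using that by (intro sum.cong) (auto simp: Q)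
  have p: "taylor_coeff p k = fps_nth Q k" for k
    by (simp add: taylor_coeff_def fps_expansion_eqI[OF pQ])
  have ineq: "(\<Sum>k\<le>N. (cmod (taylor_coeff h k))\<^sup>2 * \<rho> ^ (2 * k)) \<le> (\<Sum>k\<le>N. (cmod (fps_nth P k))\<^sup>2 * \<rho> ^ (2 * k))"
    if "0 < \<rho>" "\<rho> < 1" for \<rho> :: real
  proof -
    define M where "M = distr (restrict_space lborel {0..2 * pi}) (restrict_space borel (sphere 0 \<rho>)) (\<lambda>t. of_real \<rho> * cis t)"
    have sp: "cmod z = \<rho>" if "z \<in> space M" for z
      using that by (simp add: M_def space_restrict_space)
    have sets: "sets M = sets (restrict_space borel (sphere 0 \<rho>))" by (simp add: M_def)
    note M = circle_measure[OF less_imp_le[OF \<open>0 < \<rho>\<close>], folded M_def]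
    interpret finite_measure M by fact
    have w: "(\<integral>z. cmod z ^ (2 * k) \<partial>M) = 2 * pi * \<rho> ^ (2 * k)" for k
    proof -
      have "(\<integral>z. cmod z ^ (2 * k) \<partial>M) = (\<integral>z. \<rho> ^ (2 * k) \<partial>M)"
        by (intro Bochner_Integration.integral_cong refl) (simp add: sp)
      thus ?thesis by (simp add: M(2))
    qed
    have meas: "g \<in> borel_measurable M" if "g holomorphic_on ball 0 1" for g :: "complex \<Rightarrow> complex"
    proof -
      have "continuous_on (sphere 0 \<rho>) g"
        by (rule continuous_on_subset[OF holomorphic_on_imp_continuous_on[OF that]]) (use \<open>\<rho> < 1\<close> in auto)
      from borel_measurable_continuous_on_restrict[OF this] show ?thesis
        unfolding measurable_cong_sets[OF sets refl] .
    qed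
    have pars: "(\<lambda>k. (cmod (taylor_coeff g k))\<^sup>2 * (2 * pi * \<rho> ^ (2 * k))) sums (\<integral>z. (cmod (g z))\<^sup>2 \<partial>M)"
        "integrable M (\<lambda>z. (cmod (g z))\<^sup>2)"
      if g: "g holomorphic_on ball 0 1" for g
    proof -
      have "(\<lambda>n. taylor_coeff g n * z ^ n) sums g z" if "z \<in> space M" for z
        using taylor_coeff_sums[OF g, of z] sp[OF that] \<open>\<rho> < 1\<close> by simp
      note parseval_circular[OF M(1) sets eq_refl[OF sp] _ M(3) meas[OF g] this]
      from this[OF _ taylor_coeff_summable[OF g]] show
        "(\<lambda>k. (cmod (taylor_coeff g k))\<^sup>2 * (2 * pi * \<rho> ^ (2 * k))) sums (\<integral>z. (cmod (g z))\<^sup>2 \<partial>M)"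
        "integrable M (\<lambda>z. (cmod (g z))\<^sup>2)"
        using \<open>0 < \<rho>\<close> \<open>\<rho> < 1\<close> by (auto simp: w)
    qed
    \<comment> \<open>On the left, the terms of Parseval's identity beyond \<open>N\<close> are
      dropped; in the middle, \<open>cmod (f z) < 1\<close> compares the integrands; on the right,
      the identity for the polynomial \<open>p\<close> is exact.\<close>
    have "(\<Sum>k\<le>N. (cmod (taylor_coeff h k))\<^sup>2 * (2 * pi * \<rho> ^ (2 * k))) \<le> (\<integral>z. (cmod (h z))\<^sup>2 \<partial>M)"
      using pars(1)[OF hh] \<open>0 < \<rho>\<close> unfolding sums_iff by (metis (no_types, lifting) sum_le_suminf finite_atMost 
         zero_le_mult_iff zero_le_power2 pi_ge_zero zero_le_numeral zero_le_power less_imp_le)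
    also have "\<dots> \<le> (\<integral>z. (cmod (p z))\<^sup>2 \<partial>M)"
    proof (intro integral_mono pars hh ph)
      fix z assume "z \<in> space M"
      hence "cmod (f z) < 1" using sp \<open>\<rho> < 1\<close> by (intro f) simp
      hence "cmod (h z) \<le> cmod (p z)" unfolding h_def norm_mult by (intro mult_left_le_one_le) auto
      thus "(cmod (h z))\<^sup>2 \<le> (cmod (p z))\<^sup>2" by (intro power_mono) auto
    qed
    also have "\<dots> = (\<Sum>k\<le>N. (cmod (fps_nth P k))\<^sup>2 * (2 * pi * \<rho> ^ (2 * k)))"
    proof -
      have "(\<lambda>k. (cmod (taylor_coeff p k))\<^sup>2 * (2 * pi * \<rho> ^ (2 * k))) sums
          (\<Sum>k\<le>N. (cmod (taylor_coeff p k))\<^sup>2 * (2 * pi * \<rho> ^ (2 * k)))"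
        by (rule sums_finite) (auto simp: p Q)
      from sums_unique2[OF pars(1)[OF ph] this] show ?thesis by (simp add: p Q)
    qed
    finally have "2 * pi * (\<Sum>k\<le>N. (cmod (taylor_coeff h k))\<^sup>2 * \<rho> ^ (2 * k)) \<le> 2 * pi * (\<Sum>k\<le>N. (cmod (fps_nth P k))\<^sup>2 * \<rho> ^ (2 * k))"
      by (simp add: sum_distrib_left mult_ac)
    thus ?thesis by simp
  qed
  have lim: "((\<lambda>\<rho>. \<Sum>k\<le>N. (cmod (c k))\<^sup>2 * \<rho> ^ (2 * k)) \<longlongrightarrow> (\<Sum>k\<le>N. (cmod (c k))\<^sup>2)) (at_left (1::real))"
    for c :: "nat \<Rightarrow> complex"
    by (auto intro!: tendsto_eq_intros)
  have ev: "\<forall>\<^sub>F \<rho> in at_left (1::real). 0 < \<rho> \<and> \<rho> < 1"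
    using eventually_at_left_real[of 0 1] by simp
  have "(\<Sum>k\<le>N. (cmod (taylor_coeff h k))\<^sup>2) \<le> (\<Sum>k\<le>N. (cmod (fps_nth P k))\<^sup>2)"
    by (rule tendsto_le[OF _ lim lim]) (use ev ineq in \<open>auto elim: eventually_mono\<close>)
  thus ?thesis by (simp add: hP)
qed

text \<open>The contraction property is applied to
  \<open>P = 1 + \<tau> z ^ n + w * (\<Sum>i<n. cnj a\<^sub>i * z ^ (N - i))\<close>.\<close>

lemma coefficient_test:
  fixes \<tau> w :: complex
  assumes f: "f \<in> disc_self_maps" and n: "0 < n" "2 * n \<le> N + 1" and \<tau>: "2 * n \<le> N \<or> \<tau> = 0"
  defines "a \<equiv> taylor_coeff f" and "s \<equiv> (\<Sum>i<n. (cmod (taylor_coeff f i))\<^sup>2)"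
  shows "s + (if 2 * n \<le> N then (cmod (a n + \<tau> * a 0))\<^sup>2 else 0) + (cmod (a N + \<tau> * a (N - n) + w * s))\<^sup>2
    \<le> 1 + (cmod \<tau>)\<^sup>2 + (cmod w)\<^sup>2 * s"
proof -
  \<comment> \<open>For \<open>2 * n \<le> N\<close> the index \<open>n\<close> lies below the last
    block. For \<open>2 * n = N + 1\<close> it falls into that block, so there is no room for
    \<open>\<tau>\<close>; this is why \<open>\<tau> = 0\<close> is required in that case.\<close>
  define P where "P = Abs_fps (\<lambda>k. if k = 0 then 1 else if N - n < k \<and> k \<le> N then w * cnj (a (N - k)) 
      else if k = n then \<tau> else 0)"
  define b where "b = (\<lambda>k. fps_nth (fps_expansion f 0 * P) k)"
  have b: "b k = (\<Sum>i\<le>k. a i * fps_nth P (k - i))" for k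
    by (simp add: b_def fps_mult_nth a_def taylor_coeff_def atLeast0AtMost)
  have bk: "b k = a k" if "k < n" for k
  proof -
    have "b k = (\<Sum>i\<le>k. if i = k then a k else 0)"
      unfolding b using that n by (intro sum.cong) (auto simp: P_def)
    thus ?thesis by simp
  qed
  have bn: "b n = a n + \<tau> * a 0" if "2 * n \<le> N"
  proof -
    have "b n = (\<Sum>i\<le>n. (if i = n then a n else 0) + (if i = 0 then \<tau> * a 0 else 0))"
      unfolding b using that n by (intro sum.cong) (auto simp: P_def)
    thus ?thesis by (simp add: sum.distrib)
  qed
  \<comment> \<open>The coefficients of the last block are the conjugates of the \<open>a i\<close>
    in reverse order, so at index \<open>N\<close> they pair with the \<open>a i\<close> to give
    \<open>w * s\<close>.\<close>
  have bN: "b N = a N + \<tau> * a (N - n) + w * s"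
  proof -
    have "b N = (\<Sum>i\<le>N. (if i = N then a N else 0) + (if i = N - n then \<tau> * a (N - n) else 0) 
        + (if i < n then w * of_real ((cmod (a i))\<^sup>2) else 0))"
      unfolding b complex_norm_square using n \<tau> by (intro sum.cong) (auto simp: P_def)
    also have "\<dots> = a N + \<tau> * a (N - n) + (\<Sum>i\<le>N. if i < n then w * of_real ((cmod (a i))\<^sup>2) else 0)"
      by (simp add: sum.distrib)
    also have "(\<Sum>i\<le>N. if i < n then w * of_real ((cmod (a i))\<^sup>2) else 0) = (\<Sum>i<n. w * of_real ((cmod (a i))\<^sup>2))"
      using n by (intro sum.mono_neutral_cong_right) auto
    finally show ?thesis by (simp add: s_def a_def sum_distrib_left)
  qed
  have "(\<Sum>k\<le>N. (cmod (fps_nth P k))\<^sup>2) \<le> (\<Sum>k\<le>N. (if k = 0 then 1 else 0) + (if k = n then (cmod \<tau>)\<^sup>2 else 0)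
      + (if N - n < k then (cmod w)\<^sup>2 * (cmod (a (N - k)))\<^sup>2 else 0))"
    by (intro sum_mono) (auto simp: P_def norm_mult power_mult_distrib)
  also have "\<dots> = 1 + (cmod \<tau>)\<^sup>2 + (\<Sum>k\<le>N. if N - n < k then (cmod w)\<^sup>2 * (cmod (a (N - k)))\<^sup>2 else 0)"
    using n by (simp add: sum.distrib)
  also have "(\<Sum>k\<le>N. if N - n < k then (cmod w)\<^sup>2 * (cmod (a (N - k)))\<^sup>2 else 0) = (\<Sum>i<n. (cmod w)\<^sup>2 * (cmod (a i))\<^sup>2)"
  proof -
    have "(\<Sum>k\<le>N. if N - n < k then (cmod w)\<^sup>2 * (cmod (a (N - k)))\<^sup>2 else 0) 
      = (\<Sum>k\<in>{N-n<..N}. (cmod w)\<^sup>2 * (cmod (a (N - k)))\<^sup>2)"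
      by (intro sum.mono_neutral_cong_right) auto
    also have "\<dots> = (\<Sum>i<n. (cmod w)\<^sup>2 * (cmod (a i))\<^sup>2)"
      using n by (intro sum.reindex_bij_witness[where i = "\<lambda>i. N - i" and j = "\<lambda>k. N - k"]) auto
    finally show ?thesis .
  qed
  finally have R: "(\<Sum>k\<le>N. (cmod (fps_nth P k))\<^sup>2) \<le> 1 + (cmod \<tau>)\<^sup>2 + (cmod w)\<^sup>2 * s"
    by (simp add: s_def a_def sum_distrib_left)
  \<comment> \<open>Only the indices below \<open>n\<close>, the index \<open>n\<close> if it is
    free, and \<open>N\<close> are kept on the left; the other squares are dropped.\<close>
  have "s + (if 2 * n \<le> N then (cmod (b n))\<^sup>2 else 0) + (cmod (b N))\<^sup>2 = 
      (\<Sum>k\<in>{..<n} \<union> (if 2 * n \<le> N then {n} else {}) \<union> {N}. (cmod (b k))\<^sup>2)"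
    using n by (subst sum.union_disjoint; (subst sum.union_disjoint)?) (auto simp: s_def a_def bk)
  also have "\<dots> \<le> (\<Sum>k\<le>N. (cmod (b k))\<^sup>2)"
    using n by (intro sum_mono2) (auto split: if_splits)
  also have "\<dots> \<le> (\<Sum>k\<le>N. (cmod (fps_nth P k))\<^sup>2)"
    unfolding b_def by (rule multiplier_contraction[OF f])
  finally show ?thesis using R bn bN by (cases "2 * n \<le> N") auto
qed

lemma quadratic_test:
  fixes s B :: real
  assumes "B \<ge> 0" and *: "\<And>t. t \<ge> 0 \<Longrightarrow> s + (B + t * s)\<^sup>2 \<le> 1 + t\<^sup>2 * s"
  shows "B \<le> 1 - s"
proof -
  have 0: "s + B\<^sup>2 \<le> 1" using *[of 0] by simp
  show ?thesis
  proof (cases "s < 1")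
    case False
    hence "B\<^sup>2 \<le> 0" "s = 1" using 0 zero_le_power2[of B] by linarith+
    thus ?thesis by simp
  next
    case True
    \<comment> \<open>This is the fixed point of \<open>t \<mapsto> B + t * s\<close>. There the
      hypothesis collapses to \<open>t\<^sup>2 * (1 - s) \<le> 1 - s\<close>, so
      \<open>t \<le> 1\<close>, which is the claim.\<close>
    define t where "t = B / (1 - s)"
    have "t \<ge> 0" using True assms(1) by (simp add: t_def)
    have "B = t * (1 - s)" using True by (simp add: t_def)
    hence "B + t * s = t" by (simp add: algebra_simps)
    with *[OF \<open>t \<ge> 0\<close>] have "t\<^sup>2 * (1 - s) \<le> 1 * (1 - s)" by (simp add: algebra_simps)
    hence "t\<^sup>2 \<le> 1" using True by (subst (asm) mult_le_cancel_right) auto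
    hence "t \<le> 1" by (rule power2_le_imp_le[of t 1, simplified])
    thus ?thesis using True by (simp add: t_def field_simps)
  qed
qed

text \<open>\<open>coefficient_test\<close> with \<open>Suc n\<close> for \<open>n\<close>, with
  \<open>N = 2 * n + 1\<close> and \<open>\<tau> = 0\<close>. The phase of \<open>w\<close> is that
  of the coefficient to be bounded, so that the moduli add and \<open>quadratic_test\<close>
  applies.\<close>

lemma coeff_bound_odd:
  assumes "f \<in> disc_self_maps"
  shows "cmod (taylor_coeff f (2 * n + 1)) \<le> 1 - (\<Sum>i\<le>n. (cmod (taylor_coeff f i))\<^sup>2)"
proof (rule quadratic_test)
  fix t :: real assume "t \<ge> 0"
  define A where "A = taylor_coeff f (2 * n + 1)"
  define u where "u = cis (Arg A)"
  define s where "s = (\<Sum>i\<le>n. (cmod (taylor_coeff f i))\<^sup>2)"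
  have "s \<ge> 0" unfolding s_def by (intro sum_nonneg) auto
  have A: "A = of_real (cmod A) * u" unfolding u_def by (metis rcis_cmod_Arg rcis_def)
  have "A + of_real t * u * of_real s = of_real (cmod A + t * s) * u"
    by (subst A) (simp add: algebra_simps)
  hence "cmod (A + of_real t * u * of_real s) = \<bar>cmod A + t * s\<bar>"
    by (simp only: norm_mult norm_of_real) (simp add: u_def)
  with coefficient_test[OF assms, of "Suc n" "2 * n + 1" 0 "of_real t * u"]
  show "s + (cmod A + t * s)\<^sup>2 \<le> 1 + t\<^sup>2 * s"
    by (simp add: A_def s_def[symmetric] lessThan_Suc_atMost norm_mult u_def)
qed simp

text \<open>Choosing \<open>cmod \<tau> = cmod a\<^sub>n / (1 + cmod a\<^sub>0)\<close> gives \<open>cmod (a\<^sub>n + \<tau> * a\<^sub>0) \<ge> cmod \<tau>\<close>, so that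
  \<open>\<tau>\<close> drops out of the quadratic terms.\<close>

lemma coeff_bound_even:
  assumes "f \<in> disc_self_maps" "n > 0"
  shows "cmod (taylor_coeff f (2 * n)) \<le> 1 - (\<Sum>i<n. (cmod (taylor_coeff f i))\<^sup>2)
     - (cmod (taylor_coeff f n))\<^sup>2 / (1 + cmod (taylor_coeff f 0))"
proof -
  define A where "A = taylor_coeff f (2 * n)"
  define b where "b = taylor_coeff f n"
  define a0 where "a0 = taylor_coeff f 0"
  define T where "T = cmod b / (1 + cmod a0)"
  define u where "u = cis (Arg A)"
  define v where "v = cis (Arg b)"
  define s where "s = (\<Sum>i<n. (cmod (taylor_coeff f i))\<^sup>2)"
  \<comment> \<open>This phase makes \<open>\<tau> * b\<close> a nonnegative multiple of
    \<open>u\<close>, as \<open>A\<close> is. For \<open>N = 2 * n\<close> the index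
    \<open>N - n\<close> is \<open>n\<close>, so \<open>\<tau> * b\<close> is what
    \<open>\<tau>\<close> contributes to the coefficient of index \<open>2 * n\<close>.\<close>
  define \<tau> where "\<tau> = of_real T * u * cnj v"
  have pos: "1 + cmod a0 > 0" using norm_ge_zero[of a0] by linarith
  have "s \<ge> 0" unfolding s_def by (intro sum_nonneg) auto
  have "T \<ge> 0" using pos by (simp add: T_def)
  have A: "A = of_real (cmod A) * u" unfolding u_def by (metis rcis_cmod_Arg rcis_def)
  have b: "b = of_real (cmod b) * v" unfolding v_def by (metis rcis_cmod_Arg rcis_def)
  have v: "cnj v * v = 1" unfolding v_def cis_cnj cis_mult by simp
  have "\<tau> * b = of_real (T * cmod b) * u * (cnj v * v)"
    by (subst b) (simp add: \<tau>_def mult_ac)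
  hence \<tau>b: "\<tau> * b = of_real (T * cmod b) * u" by (simp add: v)
  have \<tau>: "cmod \<tau> = T" using \<open>T \<ge> 0\<close> by (simp add: \<tau>_def norm_mult u_def v_def)
  have "T = cmod b - T * cmod a0" using pos by (simp add: T_def field_simps)
  also have "\<dots> \<le> cmod (b + \<tau> * a0)"
    using norm_diff_ineq[of b "\<tau> * a0"] by (simp add: norm_mult \<tau>)
  finally have "T\<^sup>2 \<le> (cmod (b + \<tau> * a0))\<^sup>2" using \<open>T \<ge> 0\<close> by (intro power_mono)
  have "cmod A + T * cmod b \<le> 1 - s"
  proof (rule quadratic_test)
    fix t :: real assume "t \<ge> 0"
    have "A + \<tau> * b + of_real t * u * of_real s = of_real (cmod A + T * cmod b + t * s) * u"
      unfolding \<tau>b by (subst A) (simp add: algebra_simps)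
    hence "cmod (A + \<tau> * b + of_real t * u * of_real s) = \<bar>cmod A + T * cmod b + t * s\<bar>"
      by (simp only: norm_mult norm_of_real) (simp add: u_def)
    with coefficient_test[OF assms, of "2 * n" \<tau> "of_real t * u"] \<open>T\<^sup>2 \<le> _\<close>
    show "s + (cmod A + T * cmod b + t * s)\<^sup>2 \<le> 1 + t\<^sup>2 * s"
      by (simp add: A_def[symmetric] s_def[symmetric] b_def[symmetric] a0_def[symmetric] \<tau> norm_mult u_def)
  qed (use \<open>T \<ge> 0\<close> in simp)
  moreover have "T * cmod b = (cmod b)\<^sup>2 / (1 + cmod a0)" by (simp add: T_def power2_eq_square)
  ultimately show ?thesis by (simp add: A_def b_def a0_def s_def)
qed

section \<open>Summation of the coefficient bounds\<close>

lemma sums_partial_sums: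
  fixes c :: "nat \<Rightarrow> real"
  assumes x: "0 \<le> x" "x < 1" and c: "\<And>n. c n \<ge> 0" "\<And>n. (\<Sum>k<n. c k) \<le> K"
  shows "summable (\<lambda>n. c n * x ^ n)"
    and "(\<lambda>n. (\<Sum>k<n. c k) * x ^ n) sums (x / (1 - x) * (\<Sum>n. c n * x ^ n))"
proof -
  let ?s = "\<lambda>n. \<Sum>k<n. c k"
  have geo: "summable (\<lambda>n. K * x ^ n)" using x by (intro summable_mult summable_geometric) auto
  have s0: "?s n \<ge> 0" for n by (intro sum_nonneg c)
  have cK: "c n \<le> K" for n using c(2)[of "Suc n"] s0[of n] by simp
  show sc: "summable (\<lambda>n. c n * x ^ n)"
    by (rule summable_comparison_test'[OF geo]) (use x c cK in \<open>auto simp: abs_mult intro!: mult_right_mono\<close>)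
  have ss: "summable (\<lambda>n. ?s n * x ^ n)"
    by (rule summable_comparison_test'[OF geo]) (use x c s0 in \<open>auto simp: abs_mult intro!: mult_right_mono\<close>)
  define T where "T = (\<Sum>n. ?s n * x ^ n)"
  \<comment> \<open>The partial sum at \<open>0\<close> is empty. Dropping that term and using
    \<open>?s (Suc n) = ?s n + c n\<close> yields a linear equation for \<open>T\<close>.\<close>
  have "T = (\<Sum>n. ?s (Suc n) * x ^ Suc n)"
    unfolding T_def using suminf_split_head[OF ss] by simp
  also have "\<dots> = (\<Sum>n. x * (?s n * x ^ n + c n * x ^ n))"
    by (simp add: algebra_simps)
  also have "\<dots> = x * (T + (\<Sum>n. c n * x ^ n))"
    unfolding T_def by (subst suminf_mult) (auto simp: suminf_add ss sc intro!: summable_add)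
  finally have "T = x / (1 - x) * (\<Sum>n. c n * x ^ n)"
    using x by (simp add: field_simps)
  thus "(\<lambda>n. ?s n * x ^ n) sums (x / (1 - x) * (\<Sum>n. c n * x ^ n))"
    using ss by (simp add: T_def sums_iff)
qed

lemma coeff_square_sum_le_1:
  assumes "f \<in> disc_self_maps"
  shows "(\<Sum>i<n. (cmod (taylor_coeff f i))\<^sup>2) \<le> 1"
proof -
  have "0 \<le> 1 - (\<Sum>i\<le>n. (cmod (taylor_coeff f i))\<^sup>2)"
    using norm_ge_zero coeff_bound_odd[OF assms, of n] by (rule order.trans)
  moreover have "(\<Sum>i<n. (cmod (taylor_coeff f i))\<^sup>2) \<le> (\<Sum>i\<le>n. (cmod (taylor_coeff f i))\<^sup>2)"
    by (intro sum_mono2) auto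
  ultimately show ?thesis by linarith
qed

text \<open>Summing the two Carlson bounds, the subtracted partial sums produce the factor
  \<open>r / (1 - r)\<close> of the refinement, and the extra term of the even bound produces
  \<open>1 / (1 + a)\<close>. The refinement is thus exactly what those bounds leave over from the
  geometric majorant.\<close>

lemma refined_bohr_bound:
  assumes f: "f \<in> disc_self_maps" and r: "0 \<le> r" "r < 1"
  shows "(\<Sum>n. cmod (taylor_coeff f (Suc n)) * r ^ Suc n) + refinement f r
    \<le> (1 - (cmod (taylor_coeff f 0))\<^sup>2) * (r / (1 - r))"
proof -
  define a where "a = cmod (taylor_coeff f 0)"
  define c where "c = (\<lambda>n. (cmod (taylor_coeff f (Suc n)))\<^sup>2)"
  define \<sigma> where "\<sigma> = (\<lambda>n. \<Sum>k<n. c k)"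
  define C where "C = (\<Sum>n. c n * (r\<^sup>2) ^ n)"
  define b where "b = (\<lambda>n. cmod (taylor_coeff f (Suc n)) * r ^ Suc n)"
  have \<sigma>: "(\<Sum>i\<le>n. (cmod (taylor_coeff f i))\<^sup>2) = a\<^sup>2 + \<sigma> n" for n
    by (simp add: a_def \<sigma>_def c_def sum.atMost_shift)
  have x: "0 \<le> r\<^sup>2" "r\<^sup>2 < 1" using r by (auto simp: power_less_one_iff abs_square_less_1)
  have cK: "(\<Sum>k<n. c k) \<le> 1" for n
  proof -
    have "(\<Sum>k<n. c k) \<le> a\<^sup>2 + \<sigma> n" by (simp add: \<sigma>_def)
    also have "\<dots> \<le> 1" unfolding \<sigma>[symmetric] using coeff_square_sum_le_1[OF f, of "Suc n"]
      by (simp add: lessThan_Suc_atMost)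
    finally show ?thesis .
  qed
  have c0: "c n \<ge> 0" for n by (simp add: c_def)
  note ps = sums_partial_sums[of "r\<^sup>2" c 1, OF x c0 cK]
  have \<sigma>sums: "(\<lambda>n. \<sigma> n * (r\<^sup>2) ^ n) sums (r\<^sup>2 / (1 - r\<^sup>2) * C)"
    unfolding \<sigma>_def C_def by (rule ps(2))
  have Csums: "(\<lambda>n. c n * (r\<^sup>2) ^ n) sums C" using ps(1) by (simp add: C_def summable_sums)
  \<comment> \<open>By the index shift in \<open>b\<close>, these two terms belong to the
    coefficients of index \<open>2 * n + 1\<close> and \<open>2 * n + 2\<close>, whose bounds
    involve the same partial sum \<open>\<sigma> n\<close>.\<close>
  have pair: "b (2 * n) + b (2 * n + 1) \<le> (1 - a\<^sup>2) * (r * (1 + r)) * (r\<^sup>2) ^ n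
      - r * (1 + r) * (\<sigma> n * (r\<^sup>2) ^ n) - r\<^sup>2 / (1 + a) * (c n * (r\<^sup>2) ^ n)" for n
  proof -
    have "b (2 * n) \<le> (1 - (a\<^sup>2 + \<sigma> n)) * r ^ (2 * n + 1)"
      unfolding b_def using coeff_bound_odd[OF f, of n] r by (auto simp: \<sigma> intro!: mult_right_mono)
    moreover have "b (2 * n + 1) \<le> (1 - (a\<^sup>2 + \<sigma> n) - c n / (1 + a)) * r ^ (2 * n + 2)"
      unfolding b_def using coeff_bound_even[OF f, of "Suc n"] r
      by (auto simp: lessThan_Suc_atMost \<sigma> a_def[symmetric] c_def intro!: mult_right_mono)
    ultimately have "b (2 * n) + b (2 * n + 1) \<le> (1 - (a\<^sup>2 + \<sigma> n)) * r ^ (2 * n + 1) + 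
        (1 - (a\<^sup>2 + \<sigma> n) - c n / (1 + a)) * r ^ (2 * n + 2)" by linarith
    also have "r ^ (2 * n + 1) = r * (r\<^sup>2) ^ n" by (simp add: power_mult)
    also have "r ^ (2 * n + 2) = r\<^sup>2 * (r\<^sup>2) ^ n" by (simp add: power_mult power2_eq_square)
    also have "(1 - (a\<^sup>2 + \<sigma> n)) * (r * (r\<^sup>2) ^ n) + (1 - (a\<^sup>2 + \<sigma> n) - c n / (1 + a)) * (r\<^sup>2 * (r\<^sup>2) ^ n)
      = (1 - a\<^sup>2) * (r * (1 + r)) * (r\<^sup>2) ^ n
      - r * (1 + r) * (\<sigma> n * (r\<^sup>2) ^ n) - r\<^sup>2 / (1 + a) * (c n * (r\<^sup>2) ^ n)"
      by (simp add: algebra_simps power2_eq_square)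
    finally show ?thesis .
  qed
  have "summable b"
    unfolding b_def using taylor_coeff_summable[OF disc_self_mapsD(1)[OF f] r] by (subst summable_Suc_iff)
  from sums_group[OF summable_sums[OF this], of 2]
  have "(\<lambda>n. b (2 * n) + b (2 * n + 1)) sums suminf b"
    by (simp add: numeral_2_eq_2 mult.commute)
  moreover have "(\<lambda>n. (1 - a\<^sup>2) * (r * (1 + r)) * (r\<^sup>2) ^ n
      - r * (1 + r) * (\<sigma> n * (r\<^sup>2) ^ n) - r\<^sup>2 / (1 + a) * (c n * (r\<^sup>2) ^ n)) sums
      ((1 - a\<^sup>2) * (r * (1 + r)) * (1 / (1 - r\<^sup>2)) - r * (1 + r) * (r\<^sup>2 / (1 - r\<^sup>2) * C) - r\<^sup>2 / (1 + a) * C)"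
    using x by (intro sums_diff sums_mult \<sigma>sums Csums geometric_sums) auto
  ultimately have "suminf b \<le> (1 - a\<^sup>2) * (r * (1 + r)) * (1 / (1 - r\<^sup>2)) - r * (1 + r) * (r\<^sup>2 / (1 - r\<^sup>2) * C) - r\<^sup>2 / (1 + a) * C"
    using pair by (rule sums_le[rotated])
  also have "\<dots> = (1 - a\<^sup>2) * (r * (1 + r) / (1 - r\<^sup>2)) - (1 / (1 + a) + r * (1 + r) / (1 - r\<^sup>2)) * (r\<^sup>2 * C)"
    by (simp add: divide_inverse algebra_simps)
  also have "r * (1 + r) / (1 - r\<^sup>2) = r / (1 - r)"
  proof -
    have "1 - r\<^sup>2 = (1 - r) * (1 + r)" by (simp add: algebra_simps power2_eq_square)
    thus ?thesis using r by simp
  qed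
  finally have "suminf b \<le> (1 - a\<^sup>2) * (r / (1 - r)) - (1 / (1 + a) + r / (1 - r)) * (r\<^sup>2 * C)" .
  moreover have "(\<Sum>n. c n * r ^ (2 * Suc n)) = r\<^sup>2 * C"
  proof -
    have "c n * r ^ (2 * Suc n) = r\<^sup>2 * (c n * (r\<^sup>2) ^ n)" for n
      unfolding power_mult[of r 2] power_Suc by (simp only: mult_ac)
    thus ?thesis unfolding C_def by (simp only: suminf_mult[OF ps(1)])
  qed
  ultimately show ?thesis
    unfolding refinement_def by (simp add: a_def b_def c_def)
qed

section \<open>Rogosinski's inequality and the area bound\<close>

text \<open>Without a constant term in \<open>G\<close>, the coefficients of the product up to index
  \<open>n\<close> meet \<open>P\<close> only strictly below \<open>n\<close>. This gains one index
  over plain truncation.\<close>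

lemma fps_nth_mult_cutoff:
  fixes G P :: "'a :: comm_ring_1 fps"
  assumes "fps_nth G 0 = 0" "k \<le> n"
  shows "fps_nth (G * fps_cutoff n P) k = fps_nth (G * P) k"
  unfolding fps_mult_nth
proof (intro sum.cong refl)
  fix i assume "i \<in> {0..k}"
  thus "fps_nth G i * fps_nth (fps_cutoff n P) (k - i) = fps_nth G i * fps_nth P (k - i)"
    using assms by (cases "i = 0") auto
qed

text \<open>The Schwarz function \<open>g = (f - a\<^sub>0) / (1 - cnj a\<^sub>0 * f)\<close> satisfies
  \<open>f - a\<^sub>0 = g * (1 - cnj a\<^sub>0 * f)\<close>. As \<open>g 0 = 0\<close>, the coefficient of \<open>z ^ (n + 1)\<close> on the left
  involves only coefficients of \<open>f\<close> up to index \<open>n\<close> on the right.\<close>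

lemma rogosinski_step:
  assumes f: "f \<in> disc_self_maps"
  defines "a \<equiv> cmod (taylor_coeff f 0)"
  shows "(\<Sum>k<Suc n. (cmod (taylor_coeff f (Suc k)))\<^sup>2) \<le> (1 - a\<^sup>2)\<^sup>2 + a\<^sup>2 * (\<Sum>k<n. (cmod (taylor_coeff f (Suc k)))\<^sup>2)"
proof -
  note fD = disc_self_mapsD[OF f]
  define F where "F = fps_expansion f 0"
  have F: "f has_fps_expansion F"
    unfolding F_def using fD by (intro has_fps_expansion_fps_expansion[of "ball 0 1"]) auto
  define \<alpha> where "\<alpha> = f 0"
  have F0: "fps_nth F 0 = \<alpha>"
    by (simp add: F_def fps_expansion_def \<alpha>_def)
  have a: "a = cmod \<alpha>" by (simp add: a_def taylor_coeff_def F0 flip: F_def)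
  have "cmod \<alpha> < 1" using fD(2)[of 0] by (simp add: \<alpha>_def)
  define g where "g = Moebius_function 0 \<alpha> \<circ> f"
  have g: "g \<in> disc_self_maps"
    unfolding disc_self_maps_def g_def using fD
    by (auto intro!: holomorphic_on_compose_gen[OF fD(1) Moebius_function_holomorphic[OF \<open>cmod \<alpha> < 1\<close>]]
         Moebius_function_norm_lt_1 \<open>cmod \<alpha> < 1\<close> simp: image_subset_iff)
  note gD = disc_self_mapsD[OF g]
  define G where "G = fps_expansion g 0"
  have G: "g has_fps_expansion G"
    unfolding G_def using gD by (intro has_fps_expansion_fps_expansion[of "ball 0 1"]) auto
  have G0: "fps_nth G 0 = 0"
    by (simp add: G_def fps_expansion_def g_def \<alpha>_def Moebius_function_def)
  define P where "P = 1 - fps_const (cnj \<alpha>) * F"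
  have nz: "cnj \<alpha> * f z \<noteq> 1" if "cmod z < 1" for z
  proof
    assume "cnj \<alpha> * f z = 1"
    hence "cmod \<alpha> * cmod (f z) = 1" by (metis complex_mod_cnj norm_mult norm_one)
    moreover have "cmod \<alpha> * cmod (f z) < 1 * 1"
      using \<open>cmod \<alpha> < 1\<close> fD(2)[OF that] by (intro mult_strict_mono') auto
    ultimately show False by simp
  qed
  have "(\<lambda>z. g z * (1 - cnj \<alpha> * f z)) has_fps_expansion G * P"
    unfolding P_def by (intro fps_expansion_intros F G)
  moreover have "(\<lambda>z. f z - \<alpha>) has_fps_expansion F - fps_const \<alpha>"
    by (intro fps_expansion_intros F)
  moreover have "\<forall>\<^sub>F z in nhds 0. g z * (1 - cnj \<alpha> * f z) = f z - \<alpha>"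
    using eventually_nhds_in_open[of "ball 0 1" "0::complex"]
    by (rule eventually_mono[OF _ ]) (use nz in \<open>auto simp: g_def Moebius_function_def\<close>)
  ultimately have eq: "G * P = F - fps_const \<alpha>"
    using has_fps_expansion_cong[of "\<lambda>z. g z * (1 - cnj \<alpha> * f z)" "\<lambda>z. f z - \<alpha>" "G * P" "G * P"]
    by (auto intro: fps_expansion_unique_complex)
  have "(\<Sum>k<Suc n. (cmod (taylor_coeff f (Suc k)))\<^sup>2) = (\<Sum>k\<le>Suc n. (cmod (fps_nth (G * P) k))\<^sup>2)"
    unfolding eq by (simp add: sum.atMost_shift F0 taylor_coeff_def F_def[symmetric] lessThan_Suc_atMost del: sum.lessThan_Suc)
  \<comment> \<open>Cutting \<open>P\<close> before applying the contraction property lets the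
    right-hand side stop at \<open>n\<close> while the left-hand side runs to
    \<open>Suc n\<close>.\<close>
  also have "\<dots> = (\<Sum>k\<le>Suc n. (cmod (fps_nth (G * fps_cutoff (Suc n) P) k))\<^sup>2)"
    by (intro sum.cong refl) (simp add: fps_nth_mult_cutoff[OF G0])
  also have "\<dots> \<le> (\<Sum>k\<le>Suc n. (cmod (fps_nth (fps_cutoff (Suc n) P) k))\<^sup>2)"
    unfolding G_def by (rule multiplier_contraction[OF g])
  also have "\<dots> = (\<Sum>k\<le>n. (cmod (fps_nth P k))\<^sup>2)"
    by simp
  also have "\<dots> = (cmod (1 - cnj \<alpha> * \<alpha>))\<^sup>2 + (\<Sum>k<n. (cmod (cnj \<alpha> * fps_nth F (Suc k)))\<^sup>2)"
    by (simp add: sum.atMost_shift P_def F0)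
  also have "1 - cnj \<alpha> * \<alpha> = of_real (1 - a\<^sup>2)"
    by (simp add: a complex_norm_square mult.commute del: of_real_power)
  also have "(cmod (of_real (1 - a\<^sup>2)))\<^sup>2 = (1 - a\<^sup>2)\<^sup>2"
    by (simp only: norm_of_real power2_abs)
  also have "(\<Sum>k<n. (cmod (cnj \<alpha> * fps_nth F (Suc k)))\<^sup>2) = a\<^sup>2 * (\<Sum>k<n. (cmod (taylor_coeff f (Suc k)))\<^sup>2)"
    by (simp add: norm_mult power_mult_distrib a sum_distrib_left taylor_coeff_def F_def)
  finally show ?thesis .
qed

text \<open>The geometric sums on the right satisfy the recursion of \<open>rogosinski_step\<close>
  with equality. They are the sums of squared coefficients of a disc automorphism.\<close>

lemma rogosinski:
  assumes "f \<in> disc_self_maps"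
  defines "a \<equiv> cmod (taylor_coeff f 0)"
  shows "(\<Sum>k<n. (cmod (taylor_coeff f (Suc k)))\<^sup>2) \<le> (\<Sum>k<n. (1 - a\<^sup>2)\<^sup>2 * (a\<^sup>2) ^ k)"
proof (induction n)
  case (Suc n)
  have "(\<Sum>k<Suc n. (cmod (taylor_coeff f (Suc k)))\<^sup>2) \<le> (1 - a\<^sup>2)\<^sup>2 + a\<^sup>2 * (\<Sum>k<n. (cmod (taylor_coeff f (Suc k)))\<^sup>2)"
    unfolding a_def by (rule rogosinski_step) fact
  also have "\<dots> \<le> (1 - a\<^sup>2)\<^sup>2 + a\<^sup>2 * (\<Sum>k<n. (1 - a\<^sup>2)\<^sup>2 * (a\<^sup>2) ^ k)"
    using Suc by (intro add_left_mono mult_left_mono) auto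
  also have "\<dots> = (\<Sum>k<Suc n. (1 - a\<^sup>2)\<^sup>2 * (a\<^sup>2) ^ k)"
    by (simp add: sum.lessThan_Suc_shift sum_distrib_left mult_ac del: sum.lessThan_Suc)
  finally show ?case .
qed simp

text \<open>Abel summation in inductive form: the invariant keeps \<open>w n\<close> times the whole
  partial sum as a lower bound, and passing to the smaller weight \<open>w (Suc n)\<close> only
  weakens it since that partial sum is nonnegative.\<close>

lemma sum_weighted_mono:
  fixes w d :: "nat \<Rightarrow> real"
  assumes w: "\<And>n. 0 \<le> w n" "\<And>n. w (Suc n) \<le> w n" and d: "\<And>n. 0 \<le> (\<Sum>k<n. d k)"
  shows "0 \<le> (\<Sum>k<n. w k * d k)"
proof -
  have "w n * (\<Sum>k<n. d k) \<le> (\<Sum>k<n. w k * d k)"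
  proof (induction n)
    case (Suc n)
    have "w (Suc n) * (\<Sum>k<Suc n. d k) \<le> w n * (\<Sum>k<Suc n. d k)"
      by (intro mult_right_mono w d)
    also have "\<dots> = w n * (\<Sum>k<n. d k) + w n * d n" by (simp add: distrib_left)
    also have "\<dots> \<le> (\<Sum>k<Suc n. w k * d k)" using Suc by simp
    finally show ?case .
  qed simp
  moreover have "0 \<le> w n * (\<Sum>k<n. d k)" by (intro mult_nonneg_nonneg w d)
  ultimately show ?thesis by linarith
qed

text \<open>The differentiated geometric series. With \<open>C = (1 - a\<^sup>2)\<^sup>2\<close> it
  is the area series of a disc automorphism, used both for the bound and for sharpness.\<close>

lemma weighted_geometric_sums:
  fixes a r C :: real
  assumes "(a * r)\<^sup>2 < 1"
  shows "(\<lambda>n. real (Suc n) * (C * (a\<^sup>2) ^ n) * r ^ (2 * Suc n)) sums (C * r\<^sup>2 / (1 - a\<^sup>2 * r\<^sup>2)\<^sup>2)"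
proof -
  have "(\<lambda>n. of_nat (Suc n) * ((a * r)\<^sup>2) ^ n) sums (1 / (1 - (a * r)\<^sup>2)\<^sup>2)"
    using assms by (intro geometric_deriv_sums) auto
  from sums_mult[OF this, of "C * r\<^sup>2"] show ?thesis
    by (simp add: power_mult power_mult_distrib mult_ac power2_eq_square del: of_nat_Suc)
qed

lemma image_area_bound:
  assumes f: "f \<in> disc_self_maps" and r: "0 \<le> r" "r\<^sup>2 \<le> 1 / 2"
  defines "a \<equiv> cmod (taylor_coeff f 0)"
  shows "image_area f r / pi \<le> (1 - a\<^sup>2)\<^sup>2 * r\<^sup>2 / (1 - a\<^sup>2 * r\<^sup>2)\<^sup>2"
proof -
  note fD = disc_self_mapsD[OF f]
  have "r\<^sup>2 < 1" using r(2) by linarith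
  hence r1: "r < 1" using r(1) by (simp add: abs_square_less_1)
  have "a = cmod (f 0)" by (simp add: a_def taylor_coeff_def fps_expansion_def)
  hence a: "0 \<le> a" "a < 1" using fD(2)[of 0] by auto
  have ar: "(a * r)\<^sup>2 < 1"
  proof -
    have "a * r \<le> 1 * r" using a r by (intro mult_right_mono) auto
    hence "a * r < 1" using r1 by linarith
    thus ?thesis using a r by (simp add: abs_square_less_1)
  qed
  define w where "w = (\<lambda>n. real (Suc n) * r ^ (2 * Suc n))"
  define c where "c = (\<lambda>n. (cmod (taylor_coeff f (Suc n)))\<^sup>2)"
  define y where "y = (\<lambda>n. (1 - a\<^sup>2)\<^sup>2 * (a\<^sup>2) ^ n)"
  have w0: "w n \<ge> 0" for n using r by (simp add: w_def)
  \<comment> \<open>The ratio of consecutive weights, \<open>(n + 2) / (n + 1) * r\<^sup>2\<close>,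
    is largest at \<open>n = 0\<close>, where it is \<open>2 * r\<^sup>2\<close>; hence the
    restriction \<open>r\<^sup>2 \<le> 1 / 2\<close>.\<close>
  have wS: "w (Suc n) \<le> w n" for n
  proof -
    have "(real n + 2) * r\<^sup>2 \<le> (real n + 2) * (1 / 2)" using r by (intro mult_left_mono) auto
    moreover have "(real n + 2) * (1 / 2) \<le> real (Suc n)" by simp
    ultimately have le: "(real n + 2) * r\<^sup>2 \<le> real (Suc n)" by (rule order.trans)
    have "w (Suc n) = (real n + 2) * r\<^sup>2 * r ^ (2 * Suc n)"
      by (simp add: w_def power2_eq_square mult_ac)
    also have "\<dots> \<le> real (Suc n) * r ^ (2 * Suc n)"
      using r by (intro mult_right_mono le) auto
    finally show ?thesis by (simp add: w_def)
  qed
  have "(\<Sum>k<n. w k * c k) \<le> (\<Sum>k<n. w k * y k)" for n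
  proof -
    have "0 \<le> (\<Sum>k<n. w k * (y k - c k))"
      by (rule sum_weighted_mono[of w "\<lambda>k. y k - c k", OF w0 wS])
        (use rogosinski[OF f] in \<open>simp add: sum_subtractf y_def c_def a_def\<close>)
    thus ?thesis by (simp add: algebra_simps sum_subtractf)
  qed
  moreover have "(\<lambda>n. w n * c n) sums (image_area f r / pi)"
    using image_area_sums[OF fD(1) r(1) r1] by (simp add: w_def c_def mult_ac)
  moreover have "(\<lambda>n. w n * y n) sums ((1 - a\<^sup>2)\<^sup>2 * r\<^sup>2 / (1 - a\<^sup>2 * r\<^sup>2)\<^sup>2)"
    using weighted_geometric_sums[OF ar, of "(1 - a\<^sup>2)\<^sup>2"] by (simp add: w_def y_def mult_ac)
  ultimately show ?thesis
    unfolding sums_def by (blast intro: LIMSEQ_le)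
qed

section \<open>The two inequalities\<close>

lemma cmod_taylor_coeff_0:
  assumes "f \<in> disc_self_maps"
  shows "0 \<le> cmod (taylor_coeff f 0)" "cmod (taylor_coeff f 0) < 1"
  using disc_self_mapsD(2)[OF assms, of 0] by (auto simp: taylor_coeff_def fps_expansion_def)

lemma bohr_sum_split:
  assumes "f \<in> disc_self_maps" "0 \<le> r" "r < 1"
  shows "bohr_sum c f r = cmod (taylor_coeff f 0) + (\<Sum>n. cmod (taylor_coeff f (Suc n)) * r ^ Suc n)
    + refinement f r + c * (image_area f r / pi)"
  unfolding bohr_sum_def
  using suminf_split_head[OF taylor_coeff_summable[OF disc_self_mapsD(1)[OF assms(1)] assms(2,3)]] by simp

text \<open>Monotonicity in the radius reduces both inequalities to the largest admissible
  radius.\<close>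

lemma mono_bohr_majorant:
  fixes a r R :: real
  assumes "0 \<le> a" "a < 1" "0 \<le> r" "r \<le> R" "R < 1"
  shows "(1 - a\<^sup>2) * (r / (1 - r)) \<le> (1 - a\<^sup>2) * (R / (1 - R))"
    and "(1 - a\<^sup>2)\<^sup>2 * r\<^sup>2 / (1 - a\<^sup>2 * r\<^sup>2)\<^sup>2 \<le> (1 - a\<^sup>2)\<^sup>2 * R\<^sup>2 / (1 - a\<^sup>2 * R\<^sup>2)\<^sup>2"
proof -
  have a: "a\<^sup>2 < 1" using assms by (simp add: abs_square_less_1)
  have R: "R\<^sup>2 < 1" using assms by (simp add: abs_square_less_1)
  have rR: "r\<^sup>2 \<le> R\<^sup>2" using assms by (intro power_mono) auto
  show "(1 - a\<^sup>2) * (r / (1 - r)) \<le> (1 - a\<^sup>2) * (R / (1 - R))"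
    using assms a by (intro mult_left_mono frac_le) auto
  have "a\<^sup>2 * R\<^sup>2 \<le> a\<^sup>2 * 1" using R by (intro mult_left_mono) auto
  hence aR: "a\<^sup>2 * R\<^sup>2 < 1" using a by linarith
  have "a\<^sup>2 * r\<^sup>2 \<le> a\<^sup>2 * R\<^sup>2" using rR by (intro mult_left_mono) auto
  thus "(1 - a\<^sup>2)\<^sup>2 * r\<^sup>2 / (1 - a\<^sup>2 * r\<^sup>2)\<^sup>2 \<le> (1 - a\<^sup>2)\<^sup>2 * R\<^sup>2 / (1 - a\<^sup>2 * R\<^sup>2)\<^sup>2"
    using aR by (intro frac_le mult_left_mono[OF rR] power_mono) auto
qed

text \<open>The first two summands equal \<open>1 - (1 - a)\<^sup>2 / 2\<close>, so the area term
  has to fit into \<open>(1 - a)\<^sup>2 / 2\<close>. This amounts to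
  \<open>4 * (1 + a) \<le> 9 - a\<^sup>2\<close>, that is \<open>0 \<le> (a + 5) * (1 - a)\<close>,
  with equality at \<open>a = 1\<close>.\<close>

lemma bohr_majorant_le_1:
  fixes a :: real
  assumes "0 \<le> a" "a < 1"
  shows "a + (1 - a\<^sup>2) / 2 + 8 / 9 * ((1 - a\<^sup>2)\<^sup>2 * (1 / 3)\<^sup>2 / (1 - a\<^sup>2 * (1 / 3)\<^sup>2)\<^sup>2) \<le> 1"
proof -
  have a: "a\<^sup>2 < 1" using assms by (simp add: abs_square_less_1)
  have e: "1 - a\<^sup>2 * (1 / 3)\<^sup>2 = (9 - a\<^sup>2) / 9" by (simp add: power2_eq_square)
  have "0 \<le> (a + 5) * (1 - a)" using assms by simp
  hence "4 * (1 + a) \<le> 9 - a\<^sup>2" by (simp add: algebra_simps power2_eq_square)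
  hence "(4 * (1 + a))\<^sup>2 \<le> (9 - a\<^sup>2)\<^sup>2" using assms by (intro power_mono) auto
  hence "(4 * (1 + a))\<^sup>2 / (9 - a\<^sup>2)\<^sup>2 \<le> 1" using a by simp
  hence "((1 - a)\<^sup>2 / 2) * ((4 * (1 + a))\<^sup>2 / (9 - a\<^sup>2)\<^sup>2) \<le> ((1 - a)\<^sup>2 / 2) * 1"
    by (intro mult_left_mono) auto
  moreover have "8 / 9 * ((1 - a\<^sup>2)\<^sup>2 * (1 / 3)\<^sup>2 / (1 - a\<^sup>2 * (1 / 3)\<^sup>2)\<^sup>2) = ((1 - a)\<^sup>2 / 2) * ((4 * (1 + a))\<^sup>2 / (9 - a\<^sup>2)\<^sup>2)"
  proof -
    have "(1 - a\<^sup>2)\<^sup>2 = (1 - a)\<^sup>2 * (1 + a)\<^sup>2" unfolding power_mult_distrib[symmetric]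
      by (simp add: algebra_simps power2_eq_square)
    moreover have "(4 * (1 + a))\<^sup>2 = 16 * (1 + a)\<^sup>2"
      unfolding power_mult_distrib by simp
    ultimately show ?thesis unfolding e using a by (simp add: power_divide)
  qed
  moreover have "a + (1 - a\<^sup>2) / 2 = 1 - (1 - a)\<^sup>2 / 2" by (simp add: field_simps power2_eq_square)
  ultimately show ?thesis by linarith
qed

text \<open>The room left by the first two summands is
  \<open>(1 - a\<^sup>2) * (1 - a) / (2 - a)\<close>. Cancelling
  \<open>(1 - a\<^sup>2) * (1 - a)\<close> against the area term leaves a polynomial inequality with
  equality at \<open>a = 1\<close>.\<close>

lemma bohr_sq_majorant_le_1:
  fixes a :: real
  assumes "0 \<le> a" "a < 1"
  defines "R \<equiv> 1 / (3 - a)"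
  shows "a\<^sup>2 + (1 - a\<^sup>2) * (R / (1 - R)) + 9 / 8 * ((1 - a\<^sup>2)\<^sup>2 * R\<^sup>2 / (1 - a\<^sup>2 * R\<^sup>2)\<^sup>2) \<le> 1"
proof -
  have a: "a\<^sup>2 < 1" using assms by (simp add: abs_square_less_1)
  have R: "R / (1 - R) = 1 / (2 - a)" using assms by (simp add: R_def field_simps)
  have e: "1 - a\<^sup>2 * R\<^sup>2 = 3 * (3 - 2 * a) / (3 - a)\<^sup>2"
    using assms by (simp add: R_def power_divide field_simps) (simp add: power2_eq_square algebra_simps)
  have e2: "R\<^sup>2 / (1 - a\<^sup>2 * R\<^sup>2)\<^sup>2 = (3 - a)\<^sup>2 / (9 * (3 - 2 * a)\<^sup>2)"
  proof -
    have "(1 / x)\<^sup>2 / (3 * y / x\<^sup>2)\<^sup>2 = x\<^sup>2 / (9 * y\<^sup>2)" if "x \<noteq> 0" "y \<noteq> 0" for x y :: real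
      using that by (simp add: field_simps power2_eq_square)
    from this[of "3 - a" "3 - 2 * a"] show ?thesis
      unfolding e unfolding R_def using assms by linarith
  qed
  have "(1 + a) * (3 - a)\<^sup>2 * (2 - a) \<le> 8 * (3 - 2 * a)\<^sup>2"
  proof -
    \<comment> \<open>Expanded at the critical point \<open>a = 1\<close>, the difference of the two
      sides has only nonnegative coefficients.\<close>
    define d where "d = 1 - a"
    have d: "0 \<le> d" "d \<le> 1" using assms by (auto simp: d_def)
    have "8 * (3 - 2 * a)\<^sup>2 - (1 + a) * (3 - a)\<^sup>2 * (2 - a) = 20 * d + 30 * d^2 + 3 * d ^ 3 + d ^ 4"
      unfolding d_def by (simp add: algebra_simps power2_eq_square power3_eq_cube power4_eq_xxxx)
    thus ?thesis using d by (smt (verit) zero_le_power)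
  qed
  hence k: "(1 + a) * (3 - a)\<^sup>2 / (8 * (3 - 2 * a)\<^sup>2) \<le> 1 / (2 - a)"
    using assms by (simp add: divide_simps)
  have "9 / 8 * ((1 - a\<^sup>2)\<^sup>2 * R\<^sup>2 / (1 - a\<^sup>2 * R\<^sup>2)\<^sup>2) = 9 / 8 * ((1 - a\<^sup>2)\<^sup>2 * ((3 - a)\<^sup>2 / (9 * (3 - 2 * a)\<^sup>2)))"
    unfolding e2[symmetric] by simp
  also have "\<dots> = (1 - a\<^sup>2) * (1 - a) * ((1 + a) * (3 - a)\<^sup>2 / (8 * (3 - 2 * a)\<^sup>2))"
  proof -
    have "(1 - a\<^sup>2)\<^sup>2 = (1 - a\<^sup>2) * (1 - a) * (1 + a)" by (simp add: algebra_simps power2_eq_square)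
    thus ?thesis by simp
  qed
  also have "\<dots> \<le> (1 - a\<^sup>2) * (1 - a) * (1 / (2 - a))"
    using a assms by (intro mult_left_mono k) auto
  also have "\<dots> = 1 - a\<^sup>2 - (1 - a\<^sup>2) * (R / (1 - R))"
    unfolding R using assms by (simp add: field_simps)
  finally show ?thesis by linarith
qed

lemma bohr_sum_le_1:
  assumes f: "f \<in> disc_self_maps" and r: "0 \<le> r" "r \<le> 1 / 3"
  shows "bohr_sum (8 / 9) f r \<le> 1"
proof -
  define a where "a = cmod (taylor_coeff f 0)"
  note a = cmod_taylor_coeff_0[OF f, folded a_def]
  have "r\<^sup>2 \<le> (1 / 3)\<^sup>2" using r by (intro power_mono) auto
  hence "r\<^sup>2 \<le> 1 / 2" by (simp add: power2_eq_square)
  note area = image_area_bound[OF f r(1) this, folded a_def]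
  have "1 / 3 < (1::real)" by simp
  note mono = mono_bohr_majorant[OF a r this]
  have "bohr_sum (8 / 9) f r \<le> a + (1 - a\<^sup>2) * (r / (1 - r)) + 8 / 9 * ((1 - a\<^sup>2)\<^sup>2 * r\<^sup>2 / (1 - a\<^sup>2 * r\<^sup>2)\<^sup>2)"
    using refined_bohr_bound[OF f r(1), folded a_def] area r by (simp add: bohr_sum_split[OF f] a_def[symmetric])
  moreover have "(1 - a\<^sup>2) * (1 / 3 / (1 - 1 / 3)) = (1 - a\<^sup>2) / 2" by simp
  ultimately show ?thesis using mono bohr_majorant_le_1[OF a] by linarith
qed

lemma bohr_sum_sq_le_1:
  assumes f: "f \<in> disc_self_maps" and r: "0 \<le> r" "r \<le> 1 / (3 - cmod (taylor_coeff f 0))"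
  shows "bohr_sum_sq (9 / 8) f r \<le> 1"
proof -
  define a where "a = cmod (taylor_coeff f 0)"
  note a = cmod_taylor_coeff_0[OF f, folded a_def]
  define R where "R = 1 / (3 - a)"
  have R: "r \<le> R" "R \<le> 1 / 2" using r a by (auto simp: R_def a_def[symmetric] field_simps)
  have "r\<^sup>2 \<le> (1 / 2)\<^sup>2" using r R by (intro power_mono) auto
  hence "r\<^sup>2 \<le> 1 / 2" by (simp add: power2_eq_square)
  note area = image_area_bound[OF f r(1) this, folded a_def]
  have "bohr_sum_sq (9 / 8) f r \<le> a\<^sup>2 + (1 - a\<^sup>2) * (r / (1 - r)) + 9 / 8 * ((1 - a\<^sup>2)\<^sup>2 * r\<^sup>2 / (1 - a\<^sup>2 * r\<^sup>2)\<^sup>2)"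
    using refined_bohr_bound[OF f r(1), folded a_def] area R by (simp add: bohr_sum_sq_def a_def[symmetric])
  thus ?thesis using mono_bohr_majorant[OF a r(1) R(1)] R bohr_sq_majorant_le_1[OF a, folded R_def] by linarith
qed

section \<open>Sharpness\<close>

context
  fixes a :: real and f :: "complex \<Rightarrow> complex"
  assumes a: "0 < a" "a < 1"
  defines "f \<equiv> Moebius_function 0 (of_real a)"
begin

lemma Moebius_disc_self_map: "f \<in> disc_self_maps"
  using a Moebius_function_norm_lt_1[of "of_real a"] Moebius_function_holomorphic[of "of_real a"]
  by (auto simp: disc_self_maps_def f_def)

text \<open>From \<open>f z + a = (1 - a\<^sup>2) * z / (1 - a * z)\<close> and the geometric
  series.\<close>

lemma taylor_coeff_Moebius:
  "taylor_coeff f 0 = - of_real a" "taylor_coeff f (Suc n) = of_real ((1 - a\<^sup>2) * a ^ n)"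
proof -
  define F where "F = Abs_fps (\<lambda>n. case n of 0 \<Rightarrow> - of_real a | Suc n \<Rightarrow> complex_of_real ((1 - a\<^sup>2) * a ^ n))"
  have "f has_fps_expansion F"
  proof (rule has_fps_expansionI)
    have "(\<lambda>n. fps_nth F n * z ^ n) sums f z" if z: "z \<in> ball 0 1" for z
    proof -
      have "cmod (of_real a * z) < 1 * 1"
        using z a unfolding norm_mult by (intro mult_strict_mono') auto
      hence az: "cmod (of_real a * z) < 1" by simp
      hence ne: "1 - of_real a * z \<noteq> 0" by auto
      from geometric_sums[OF az] 
      have "(\<lambda>n. of_real (1 - a\<^sup>2) * z * (of_real a * z) ^ n) sums (of_real (1 - a\<^sup>2) * z * (1 / (1 - of_real a * z)))"
        by (rule sums_mult)
      also have "(\<lambda>n. of_real (1 - a\<^sup>2) * z * (of_real a * z) ^ n) = (\<lambda>n. fps_nth F (Suc n) * z ^ Suc n)"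
        by (simp add: F_def power_mult_distrib mult_ac)
      also have "of_real (1 - a\<^sup>2) * z * (1 / (1 - of_real a * z)) = f z - fps_nth F 0 * z ^ 0"
        using ne by (simp add: f_def F_def Moebius_function_def field_simps power2_eq_square)
      finally show ?thesis by (subst (asm) sums_Suc_iff) simp
    qed
    thus "\<forall>\<^sub>F z in nhds 0. (\<lambda>n. fps_nth F n * z ^ n) sums f z"
      using eventually_nhds_in_open[of "ball 0 1" "0::complex"] by (auto elim: eventually_mono)
  qed
  from fps_expansion_eqI[OF this]
  show "taylor_coeff f 0 = - of_real a" "taylor_coeff f (Suc n) = of_real ((1 - a\<^sup>2) * a ^ n)"
    by (simp_all add: taylor_coeff_def F_def)
qed

lemma cmod_taylor_coeff_Moebius:
  "cmod (taylor_coeff f 0) = a" "cmod (taylor_coeff f (Suc n)) = (1 - a\<^sup>2) * a ^ n"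
proof -
  have "a\<^sup>2 < 1" using a by (simp add: abs_square_less_1)
  thus "cmod (taylor_coeff f 0) = a" "cmod (taylor_coeff f (Suc n)) = (1 - a\<^sup>2) * a ^ n"
    using a unfolding taylor_coeff_Moebius norm_minus_cancel norm_of_real by auto
qed

lemma bohr_terms_Moebius:
  assumes r: "0 \<le> r" "r < 1"
  shows "(\<Sum>n. cmod (taylor_coeff f (Suc n)) * r ^ Suc n) = (1 - a\<^sup>2) * r / (1 - a * r)"
    and "refinement f r = (1 / (1 + a) + r / (1 - r)) * ((1 - a\<^sup>2)\<^sup>2 * r\<^sup>2 / (1 - a\<^sup>2 * r\<^sup>2))"
    and "image_area f r / pi = (1 - a\<^sup>2)\<^sup>2 * r\<^sup>2 / (1 - a\<^sup>2 * r\<^sup>2)\<^sup>2"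
proof -
  have "a * r \<le> a * 1" using a r by (intro mult_left_mono) auto
  hence "a * r < 1" using a by linarith
  hence ar: "0 \<le> a * r" "a * r < 1" using a r by auto
  hence ar2: "(a * r)\<^sup>2 < 1" by (simp add: abs_square_less_1)
  have "(\<lambda>n. (a * r) ^ n) sums (1 / (1 - a * r))" using ar by (intro geometric_sums) auto
  from sums_mult[OF this, of "(1 - a\<^sup>2) * r"]
  have "(\<lambda>n. cmod (taylor_coeff f (Suc n)) * r ^ Suc n) sums ((1 - a\<^sup>2) * r / (1 - a * r))"
    by (simp add: cmod_taylor_coeff_Moebius power_mult_distrib mult_ac)
  thus "(\<Sum>n. cmod (taylor_coeff f (Suc n)) * r ^ Suc n) = (1 - a\<^sup>2) * r / (1 - a * r)"
    by (rule sums_unique[symmetric])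
  have "(\<lambda>n. ((a * r)\<^sup>2) ^ n) sums (1 / (1 - (a * r)\<^sup>2))" using ar2 by (intro geometric_sums) auto
  have sq: "(cmod (taylor_coeff f (Suc n)))\<^sup>2 = (1 - a\<^sup>2)\<^sup>2 * (a\<^sup>2) ^ n" for n
    by (simp add: cmod_taylor_coeff_Moebius power_mult_distrib power_mult[symmetric] mult.commute)
  have "(1 - a\<^sup>2)\<^sup>2 * (a\<^sup>2) ^ n * r ^ (2 * Suc n) = (1 - a\<^sup>2)\<^sup>2 * r\<^sup>2 * ((a * r)\<^sup>2) ^ n" for n
    unfolding power_mult[of r 2] power_Suc power_mult_distrib by (simp only: mult_ac)
  with sums_mult[OF \<open>(\<lambda>n. ((a * r)\<^sup>2) ^ n) sums _\<close>, of "(1 - a\<^sup>2)\<^sup>2 * r\<^sup>2"]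
  have "(\<lambda>n. (cmod (taylor_coeff f (Suc n)))\<^sup>2 * r ^ (2 * Suc n)) sums ((1 - a\<^sup>2)\<^sup>2 * r\<^sup>2 / (1 - a\<^sup>2 * r\<^sup>2))"
    unfolding sq by (simp only: power_mult_distrib) simp
  thus "refinement f r = (1 / (1 + a) + r / (1 - r)) * ((1 - a\<^sup>2)\<^sup>2 * r\<^sup>2 / (1 - a\<^sup>2 * r\<^sup>2))"
    unfolding refinement_def cmod_taylor_coeff_Moebius(1) by (simp add: sums_iff)
  from image_area_sums[OF disc_self_mapsD(1)[OF Moebius_disc_self_map] r]
  have "(\<lambda>n. real (Suc n) * ((1 - a\<^sup>2)\<^sup>2 * (a\<^sup>2) ^ n) * r ^ (2 * Suc n)) sums (image_area f r / pi)"
    unfolding sq .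
  from sums_unique2[OF this weighted_geometric_sums[OF ar2]]
  show "image_area f r / pi = (1 - a\<^sup>2)\<^sup>2 * r\<^sup>2 / (1 - a\<^sup>2 * r\<^sup>2)\<^sup>2" .
qed

end

text \<open>The plain Bohr sum of an automorphism already exceeds 1 once
  \<open>1 - a * r < r * (1 + a)\<close>, that is \<open>a > (1 / r - 1) / 2\<close>. Such an
  \<open>a < 1\<close> exists because \<open>r > 1 / 3\<close>.\<close>

lemma bohr_sum_Moebius_gt_1:
  assumes "1 / 3 < r" "r < 1"
  obtains f where "f \<in> disc_self_maps" "bohr_sum (8 / 9) f r > 1"
proof -
  have "(1 / r - 1) / 2 < 1" using assms by (simp add: field_simps)
  then obtain a where a: "0 < a" "a < 1" "(1 / r - 1) / 2 < a"
    using dense[of "max 0 ((1 / r - 1) / 2)" 1] by auto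
  have a3: "1 - a * r < r * (1 + a)" using a(3) assms by (simp add: field_simps)
  have a2: "a\<^sup>2 < 1" using a by (simp add: abs_square_less_1)
  have ar: "a * r < 1" using a assms mult_strict_mono'[of a 1 r 1] by simp
  have ar2: "a\<^sup>2 * r\<^sup>2 < 1" using a assms ar by (simp add: abs_square_less_1 flip: power_mult_distrib)
  define f where "f = Moebius_function 0 (of_real a)"
  have f: "f \<in> disc_self_maps" unfolding f_def by (rule Moebius_disc_self_map[OF a(1,2)])
  have r: "0 \<le> r" "r < 1" using assms by auto
  note T = bohr_terms_Moebius[OF a(1,2) r, folded f_def]
  have "(1 - a\<^sup>2) * r / (1 - a * r) = (1 - a) * (r * (1 + a) / (1 - a * r))"
    by (simp add: algebra_simps power2_eq_square)
  also have "\<dots> > (1 - a) * 1" using a a3 ar by (intro mult_strict_left_mono) auto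
  finally have "(1 - a\<^sup>2) * r / (1 - a * r) > 1 - a" by simp
  moreover have "0 \<le> (1 / (1 + a) + r / (1 - r)) * ((1 - a\<^sup>2)\<^sup>2 * r\<^sup>2 / (1 - a\<^sup>2 * r\<^sup>2))"
    using a r ar2 by (intro mult_nonneg_nonneg add_nonneg_nonneg divide_nonneg_nonneg) auto
  moreover have "0 \<le> 8 / 9 * ((1 - a\<^sup>2)\<^sup>2 * r\<^sup>2 / (1 - a\<^sup>2 * r\<^sup>2)\<^sup>2)" by simp
  ultimately have "bohr_sum (8 / 9) f r > 1"
    unfolding bohr_sum_split[OF f r] T unfolding f_def cmod_taylor_coeff_Moebius[OF a(1,2)] by linarith
  with f show thesis by (rule that)
qed

lemma isCont_pos_witness_below_1:
  fixes E :: "real \<Rightarrow> real"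
  assumes "isCont E 1" "E 1 > 0"
  obtains a where "0 < a" "a < 1" "E a > 0"
proof -
  have "(E \<longlongrightarrow> E 1) (at_left 1)"
    using assms(1) unfolding isCont_def by (rule filterlim_mono[OF _ order_refl at_le]) auto
  hence "\<forall>\<^sub>F a in at_left 1. E a > 0" using assms(2) by (rule order_tendstoD)
  moreover have "\<forall>\<^sub>F a in at_left (1::real). a \<in> {0<..<1}"
    by (rule eventually_at_left_real) simp
  ultimately have "\<forall>\<^sub>F a in at_left (1::real). a \<in> {0<..<1} \<and> E a > 0"
    by eventually_elim auto
  from eventually_happens'[OF _ this] obtain a where "a \<in> {0<..<1}" "E a > 0" by auto
  thus thesis by (intro that) auto
qed

text \<open>For the automorphism with \<open>f 0 = - a\<close>, the sum exceeds 1 by \<open>(1 - a)\<^sup>2 * E a\<close> with \<open>E 1 > 0\<close>.\<close>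

lemma bohr_sum_constant_sharp:
  assumes "c > 8 / 9"
  obtains f where "f \<in> disc_self_maps" "bohr_sum c f (1 / 3) > 1"
proof -
  \<comment> \<open>The summands come from the Bohr sum, the refinement and the area. At
    \<open>a = 1\<close> they add up to \<open>- 1 + 1 / 2 + 9 * c / 16\<close>, which is positive
    exactly for \<open>c > 8 / 9\<close>.\<close>
  define E where "E = (\<lambda>a::real. - 2 / (3 - a) + (1 + a) * (1 + (1 + a) / 2) / (9 - a\<^sup>2)
      + 9 * c * (1 + a)\<^sup>2 / (9 - a\<^sup>2)\<^sup>2)"
  have "isCont E 1" unfolding E_def by (intro continuous_intros) auto
  moreover have "E 1 > 0" using assms by (simp add: E_def)
  ultimately obtain a where a: "0 < a" "a < 1" "E a > 0" by (rule isCont_pos_witness_below_1)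
  have a2: "a\<^sup>2 < 1" using a by (simp add: abs_square_less_1)
  define f where "f = Moebius_function 0 (of_real a)"
  have f: "f \<in> disc_self_maps" unfolding f_def by (rule Moebius_disc_self_map[OF a(1,2)])
  have r: "0 \<le> 1 / (3::real)" "1 / (3::real) < 1" by auto
  note T = bohr_terms_Moebius[OF a(1,2) r, folded f_def]
  have d: "1 + a \<noteq> 0" "3 - a \<noteq> 0" "9 - a\<^sup>2 \<noteq> 0" using a a2 by auto
  have e: "1 - a * (1 / 3) = (3 - a) / 3" "1 - a\<^sup>2 * (1 / 3)\<^sup>2 = (9 - a\<^sup>2) / 9"
    "1 / 3 / (1 - 1 / 3) = 1 / (2::real)" by (auto simp: power2_eq_square)
  have m: "1 - a\<^sup>2 = (1 - a) * (1 + a)" by (simp add: algebra_simps power2_eq_square)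
  have "a + (1 - a\<^sup>2) * (1 / 3) / (1 - a * (1 / 3)) - 1 = ((a - 1) * (3 - a) + (1 - a\<^sup>2)) / (3 - a)"
  proof -
    have "x * (1 / 3) / (y / 3) = x / y" for x y :: real by simp
    thus ?thesis unfolding e using d by (simp only: add_divide_distrib) simp
  qed
  also have "(a - 1) * (3 - a) + (1 - a\<^sup>2) = (1 - a)\<^sup>2 * (- 2)"
    by (simp add: algebra_simps power2_eq_square)
  finally have "a + (1 - a\<^sup>2) * (1 / 3) / (1 - a * (1 / 3)) - 1 = (1 - a)\<^sup>2 * (- 2 / (3 - a))" by simp
  moreover have "(1 / (1 + a) + 1 / 3 / (1 - 1 / 3)) * ((1 - a\<^sup>2)\<^sup>2 * (1 / 3)\<^sup>2 / (1 - a\<^sup>2 * (1 / 3)\<^sup>2))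
      = (1 - a)\<^sup>2 * ((1 + a) * (1 + (1 + a) / 2) / (9 - a\<^sup>2))"
  proof -
    have "(1 / (1 + a) + 1 / 2) * (1 + a) = 1 + (1 + a) / 2" using d by (simp add: field_simps)
    moreover have "(1 / (1 + a) + 1 / 2) * (1 + a)\<^sup>2 = (1 + a) * ((1 / (1 + a) + 1 / 2) * (1 + a))"
      by (simp only: power2_eq_square mult_ac)
    ultimately have "(1 / (1 + a) + 1 / 2) * (1 + a)\<^sup>2 = (1 + a) * (1 + (1 + a) / 2)"
      by (simp only:)
    moreover have "(1 / (1 + a) + 1 / 2) * ((1 - a\<^sup>2)\<^sup>2 * (1 / 3)\<^sup>2 / ((9 - a\<^sup>2) / 9)) 
       = (1 - a)\<^sup>2 * (((1 / (1 + a) + 1 / 2) * (1 + a)\<^sup>2) / (9 - a\<^sup>2))"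
      by (subst (1) m) (simp add: power_mult_distrib power_divide)
    ultimately show ?thesis unfolding e by simp
  qed
  moreover have "c * ((1 - a\<^sup>2)\<^sup>2 * (1 / 3)\<^sup>2 / (1 - a\<^sup>2 * (1 / 3)\<^sup>2)\<^sup>2) = (1 - a)\<^sup>2 * (9 * c * (1 + a)\<^sup>2 / (9 - a\<^sup>2)\<^sup>2)"
    unfolding e by (subst (1) m) (simp add: power_mult_distrib power_divide)
  ultimately have "bohr_sum c f (1 / 3) - 1 = (1 - a)\<^sup>2 * E a"
    unfolding bohr_sum_split[OF f r] T unfolding f_def cmod_taylor_coeff_Moebius[OF a(1,2)] E_def distrib_left
    by linarith
  hence "bohr_sum c f (1 / 3) > 1" using a by (smt (verit) mult_pos_pos zero_less_power)
  with f show thesis by (rule that)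
qed

text \<open>For the automorphism with \<open>f 0 = - a\<close> at the endpoint radius
  \<open>1 / (3 - a)\<close>, the excess over 1 is \<open>(1 - a\<^sup>2) * (1 - a) * E a\<close>.
  Here \<open>E 1 = 8 * c / 9 - 1\<close>, so the excess is positive for some \<open>a\<close> close
  to 1.\<close>

lemma bohr_sum_sq_constant_sharp:
  assumes "c > 9 / 8"
  obtains f where "f \<in> disc_self_maps" "bohr_sum_sq c f (1 / (3 - cmod (taylor_coeff f 0))) > 1"
proof -
  define E where "E = (\<lambda>a::real. - 2 / (3 - 2 * a) + (1 + a) * ((1 / (1 + a) + 1 / (2 - a)) * ((1 / (3 - a))\<^sup>2 / (1 - a\<^sup>2 * (1 / (3 - a))\<^sup>2))
     + c * ((1 / (3 - a))\<^sup>2 / (1 - a\<^sup>2 * (1 / (3 - a))\<^sup>2)\<^sup>2)))"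
  have "isCont E 1" unfolding E_def by (intro continuous_intros) (auto simp: power2_eq_square)
  moreover have "E 1 > 0" using assms by (simp add: E_def power2_eq_square)
  ultimately obtain a where a: "0 < a" "a < 1" "E a > 0" by (rule isCont_pos_witness_below_1)
  have a2: "a\<^sup>2 < 1" using a by (simp add: abs_square_less_1)
  define f where "f = Moebius_function 0 (of_real a)"
  define r where "r = 1 / (3 - a)"
  have f: "f \<in> disc_self_maps" unfolding f_def by (rule Moebius_disc_self_map[OF a(1,2)])
  have r: "0 \<le> r" "r < 1" using a by (auto simp: r_def)
  note T = bohr_terms_Moebius[OF a(1,2) r, folded f_def]
  have d: "3 - 2 * a \<noteq> 0" "3 - a \<noteq> 0" "2 - a \<noteq> 0" using a by auto
  have e: "r / (1 - a * r) = 1 / (3 - 2 * a)" "r / (1 - r) = 1 / (2 - a)"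
    using d by (auto simp: r_def divide_simps)
  have m: "1 - a\<^sup>2 = (1 - a) * (1 + a)" by (simp add: algebra_simps power2_eq_square)
  have "a\<^sup>2 + (1 - a\<^sup>2) * r / (1 - a * r) - 1 = (1 - a\<^sup>2) * (1 / (3 - 2 * a) - 1)"
    unfolding e(1)[symmetric] by (simp add: algebra_simps)
  also have "1 / (3 - 2 * a) - 1 = (1 - a) * (- 2 / (3 - 2 * a))"
    using d by (simp add: divide_simps)
  finally have "a\<^sup>2 + (1 - a\<^sup>2) * r / (1 - a * r) - 1 = (1 - a\<^sup>2) * (1 - a) * (- 2 / (3 - 2 * a))" by simp
  moreover have "(1 / (1 + a) + r / (1 - r)) * ((1 - a\<^sup>2)\<^sup>2 * r\<^sup>2 / (1 - a\<^sup>2 * r\<^sup>2))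
      = (1 - a\<^sup>2) * (1 - a) * ((1 + a) * ((1 / (1 + a) + 1 / (2 - a)) * (r\<^sup>2 / (1 - a\<^sup>2 * r\<^sup>2))))"
    unfolding e power2_eq_square[of "1 - a\<^sup>2"] by (subst (2) m) (simp only: mult_ac times_divide_eq_right)
  moreover have "c * ((1 - a\<^sup>2)\<^sup>2 * r\<^sup>2 / (1 - a\<^sup>2 * r\<^sup>2)\<^sup>2)
      = (1 - a\<^sup>2) * (1 - a) * ((1 + a) * (c * (r\<^sup>2 / (1 - a\<^sup>2 * r\<^sup>2)\<^sup>2)))"
    unfolding power2_eq_square[of "1 - a\<^sup>2"] by (subst (2) m) (simp only: mult_ac times_divide_eq_right)
  ultimately have "bohr_sum_sq c f r - 1 = (1 - a\<^sup>2) * (1 - a) * E a"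
    unfolding bohr_sum_sq_def T unfolding f_def cmod_taylor_coeff_Moebius[OF a(1,2)] E_def r_def[symmetric] distrib_left
    by linarith
  moreover have "(1 - a\<^sup>2) * (1 - a) * E a > 0" using a a2 by (intro mult_pos_pos) auto
  ultimately have "bohr_sum_sq c f r > 1" by linarith
  moreover have "1 / (3 - cmod (taylor_coeff f 0)) = r"
    unfolding f_def cmod_taylor_coeff_Moebius[OF a(1,2)] r_def ..
  ultimately show thesis using f that by metis
qed

theorem theorem4:
  shows "(\<forall>f\<in>disc_self_maps. \<forall>r::real. 0 \<le> r \<and> r \<le> 1/3 \<longrightarrow> bohr_sum (8/9) f r \<le> 1)
    \<and> (\<forall>R::real. R > 1/3 \<longrightarrow>
           \<not> (\<forall>f\<in>disc_self_maps. \<forall>r. 0 \<le> r \<and> r \<le> R \<and> r < 1 \<longrightarrow> bohr_sum (8/9) f r \<le> 1))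
    \<and> (\<forall>c::real. c > 8/9 \<longrightarrow>
           \<not> (\<forall>f\<in>disc_self_maps. \<forall>r. 0 \<le> r \<and> r \<le> 1/3 \<longrightarrow> bohr_sum c f r \<le> 1))
    \<and> (\<forall>f\<in>disc_self_maps. \<forall>r::real. 0 \<le> r \<and> r \<le> 1 / (3 - cmod (taylor_coeff f 0))
           \<longrightarrow> bohr_sum_sq (9/8) f r \<le> 1)
    \<and> (\<forall>c::real. c > 9/8 \<longrightarrow>
           \<not> (\<forall>f\<in>disc_self_maps. \<forall>r. 0 \<le> r \<and> r \<le> 1 / (3 - cmod (taylor_coeff f 0))
                \<longrightarrow> bohr_sum_sq c f r \<le> 1))"
proof (intro conjI allI impI ballI notI)
  fix f and r :: real
  assume "f \<in> disc_self_maps" "0 \<le> r \<and> r \<le> 1 / 3"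
  thus "bohr_sum (8/9) f r \<le> 1" by (intro bohr_sum_le_1) auto
next
  fix R :: real
  assume R: "R > 1 / 3"
    and *: "\<forall>f\<in>disc_self_maps. \<forall>r. 0 \<le> r \<and> r \<le> R \<and> r < 1 \<longrightarrow> bohr_sum (8/9) f r \<le> 1"
  \<comment> \<open>\<open>R\<close> may be 1 or larger, so a radius in the unit interval is chosen
    that still exceeds \<open>1 / 3\<close>.\<close>
  define r where "r = min R (1 / 2)"
  have r: "1 / 3 < r" "r < 1" "r \<le> R" using R by (auto simp: r_def)
  obtain f where "f \<in> disc_self_maps" "bohr_sum (8/9) f r > 1"
    using bohr_sum_Moebius_gt_1[OF r(1,2)] by metis
  thus False using * r by (smt (verit) divide_nonneg_nonneg)
next
  fix c :: real
  assume c: "c > 8 / 9" and *: "\<forall>f\<in>disc_self_maps. \<forall>r. 0 \<le> r \<and> r \<le> 1/3 \<longrightarrow> bohr_sum c f r \<le> 1"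
  obtain f where "f \<in> disc_self_maps" "bohr_sum c f (1 / 3) > 1"
    using bohr_sum_constant_sharp[OF c] by metis
  thus False using *[rule_format, of f "1 / 3"] by simp
next
  fix f and r :: real
  assume "f \<in> disc_self_maps" "0 \<le> r \<and> r \<le> 1 / (3 - cmod (taylor_coeff f 0))"
  thus "bohr_sum_sq (9/8) f r \<le> 1" by (intro bohr_sum_sq_le_1) auto
next
  fix c :: real
  assume c: "c > 9 / 8" and *: "\<forall>f\<in>disc_self_maps. \<forall>r. 0 \<le> r \<and> r \<le> 1 / (3 - cmod (taylor_coeff f 0))
      \<longrightarrow> bohr_sum_sq c f r \<le> 1"
  obtain f where f: "f \<in> disc_self_maps" "bohr_sum_sq c f (1 / (3 - cmod (taylor_coeff f 0))) > 1"
    using bohr_sum_sq_constant_sharp[OF c] by metis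
  have "0 \<le> 1 / (3 - cmod (taylor_coeff f 0))" using cmod_taylor_coeff_0[OF f(1)] by simp
  thus False using *[rule_format, of f] f by fastforce
qed

end
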